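(* Let $(X_1,y_1),\dots,(X_n,y_n)$ be i.i.d. from the adaptive response contamination model with dimension $p$, contamination rate $\epsilon$, regression vector $\beta\in\mathbb{R}^p$, noise level $\sigma>0$ and an arbitrary contamination kernel $Q$. For $t\ge 0$ let $\widehat\beta\in\arg\max_{\widetilde\beta\in\mathbb{R}^p}\mathcal{D}(\widetilde\beta,\mathbb{P}_n,t)$ be a maximizer of the empirical truncated regression depth. For any $\alpha\in(0,1)$ there exist constants $C,c>0$ (depending only on $\alpha$) such that whenever $\sqrt{p/n}+\epsilon\le c$ and $t\in[0,\sqrt{0.4\log(n/p)}]$, the estimator satisfies $$\|\widehat\beta-\beta\|_2\le C\,\frac{\sigma}{t}\left(\sqrt{\frac{p}{n}}\,e^{t^2}+\epsilon\right)$$ with probability at least $1-\alpha$. Consequently, with $t=\tfrac12\sqrt{\log(n\epsilon^2/p+e)}$, the estimator achieves the error rate $$\sigma\left(\sqrt{\frac{p}{n}}+\frac{\epsilon}{\sqrt{\log(n\epsilon^2/p+e)}}\right),$$ i.e. (under $\sqrt{p/n}+\epsilon\le c$) $\|\widehat\beta-\beta\|_2$ is at most a constant depending only on $\alpha$ times this quantity, with probability at least $1-\alpha$.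
   Context: Adaptive response contamination model: $\epsilon\in[0,1/2)$, $p\in\mathbb{N}$; $(X_i,y_i)$, $i=1,\dots,n$, are i.i.d. with $X_i\sim\mathcal{N}(0,I_p)$ and $y_i\mid X_i\sim(1-\epsilon)\mathcal{N}(X_i^\top\beta,\sigma^2)+\epsilon Q_{X_i}$, where $Q_x$ is an arbitrary conditional distribution on $\mathbb{R}$ depending on $x$. Empirical truncated regression depth: with $\mathcal{S}^{p-1}$ the unit sphere of $\mathbb{R}^p$, $$\mathcal{D}(\widetilde\beta,\mathbb{P}_n,t)=\inf_{v\in\mathcal{S}^{p-1}}\frac1n\sum_{i=1}^n\mathbf{1}\{v^\top X_i(y_i-X_i^\top\widetilde\beta)\ge 0,\ |v^\top X_i|\ge t\}.$$ For $t=0$ the right-hand side of the error bound is read as $+\infty$. Logarithms are natural. *)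

theory Defs
  imports "HOL-Probability.Probability"
begin

text \<open>
  The dimension \<open>p\<close> has to be quantified inside the theorem (the constants must not depend on it),
  so a vector of \<open>\<real>\<^sup>p\<close> is a function on \<open>nat\<close> that is \<open>undefined\<close> outside \<open>{..<p}\<close>,
  and the Borel space on \<open>\<real>\<^sup>p\<close> is the product space \<open>\<Pi>\<^sub>M i\<in>{..<p}. borel\<close>.
  The Euclidean norm of \<open>v\<close> is \<open>L2_set v {..<p}\<close>.
\<close>

type_synonym vec = "nat \<Rightarrow> real"

text \<open>A sample maps \<open>i < n\<close> to the observation \<open>(X\<^sub>i, y\<^sub>i)\<close>.\<close>

type_synonym sample = "nat \<Rightarrow> vec \<times> real"

definition Rvec :: "nat \<Rightarrow> vec set" where
  "Rvec p = {..<p} \<rightarrow>\<^sub>E (UNIV :: real set)"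

definition dotp :: "nat \<Rightarrow> vec \<Rightarrow> vec \<Rightarrow> real" where
  "dotp p u v = (\<Sum>i<p. u i * v i)"

definition unit_sphere :: "nat \<Rightarrow> vec set" where
  "unit_sphere p = {v \<in> Rvec p. L2_set v {..<p} = 1}"

definition borel_vec :: "nat \<Rightarrow> vec measure" where
  "borel_vec p = (\<Pi>\<^sub>M i\<in>{..<p}. borel)"

text \<open>\<open>normal_law m s\<close> is \<open>\<N>(m, s\<^sup>2)\<close>: the second argument is the standard deviation.\<close>

definition normal_law :: "real \<Rightarrow> real \<Rightarrow> real measure" where
  "normal_law m s = density lborel (\<lambda>x. ennreal (normal_density m s x))"

definition std_gaussian_vec :: "nat \<Rightarrow> vec measure" where
  "std_gaussian_vec p = (\<Pi>\<^sub>M i\<in>{..<p}. normal_law 0 1)"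

text \<open>
  The mixture \<open>(1 - \<epsilon>) \<N>(x\<^sup>T\<beta>, \<sigma>\<^sup>2) + \<epsilon> Q\<^sub>x\<close>, written as the law obtained by first
  drawing the contamination flag; its values are given by \<open>emeasure_response_law\<close> below.
\<close>

definition response_law ::
    "nat \<Rightarrow> real \<Rightarrow> vec \<Rightarrow> real \<Rightarrow> (vec \<Rightarrow> real measure) \<Rightarrow> vec \<Rightarrow> real measure" where
  "response_law p \<epsilon> \<beta> \<sigma> Q x =
     measure_pmf (bernoulli_pmf \<epsilon>) \<bind> (\<lambda>b. if b then Q x else normal_law (dotp p x \<beta>) \<sigma>)"

definition obs_law ::
    "nat \<Rightarrow> real \<Rightarrow> vec \<Rightarrow> real \<Rightarrow> (vec \<Rightarrow> real measure) \<Rightarrow> (vec \<times> real) measure" where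
  "obs_law p \<epsilon> \<beta> \<sigma> Q =
     std_gaussian_vec p \<bind> (\<lambda>x. response_law p \<epsilon> \<beta> \<sigma> Q x \<bind>
       (\<lambda>y. return (borel_vec p \<Otimes>\<^sub>M borel) (x, y)))"

definition sample_law ::
    "nat \<Rightarrow> nat \<Rightarrow> real \<Rightarrow> vec \<Rightarrow> real \<Rightarrow> (vec \<Rightarrow> real measure) \<Rightarrow> sample measure" where
  "sample_law n p \<epsilon> \<beta> \<sigma> Q = (\<Pi>\<^sub>M i\<in>{..<n}. obs_law p \<epsilon> \<beta> \<sigma> Q)"

definition adaptive_contamination_model ::
    "nat \<Rightarrow> nat \<Rightarrow> real \<Rightarrow> vec \<Rightarrow> real \<Rightarrow> (vec \<Rightarrow> real measure) \<Rightarrow> bool" where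
  "adaptive_contamination_model n p \<epsilon> \<beta> \<sigma> Q \<longleftrightarrow>
     1 \<le> n \<and> 1 \<le> p \<and> 0 \<le> \<epsilon> \<and> \<epsilon> < 1/2 \<and> \<beta> \<in> Rvec p \<and> 0 < \<sigma> \<and>
     Q \<in> borel_vec p \<rightarrow>\<^sub>M prob_algebra borel"

definition trunc_depth :: "nat \<Rightarrow> nat \<Rightarrow> vec \<Rightarrow> sample \<Rightarrow> real \<Rightarrow> real" where
  "trunc_depth n p b S t =
     (INF v\<in>unit_sphere p. 1 / real n *
        (\<Sum>i<n. case S i of (x, y) \<Rightarrow>
           of_bool (dotp p v x * (y - dotp p x b) \<ge> 0 \<and> \<bar>dotp p v x\<bar> \<ge> t)))"

text \<open>
  An estimator is an arbitrary selection from the set of maximizers (which are in general not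
  unique); no measurability is required of it.
\<close>

definition max_depth_estimator :: "nat \<Rightarrow> nat \<Rightarrow> real \<Rightarrow> (sample \<Rightarrow> vec) \<Rightarrow> bool" where
  "max_depth_estimator n p t est \<longleftrightarrow>
     (\<forall>S \<in> {..<n} \<rightarrow>\<^sub>E (Rvec p \<times> UNIV).
        is_arg_max (\<lambda>b. trunc_depth n p b S t) (\<lambda>b. b \<in> Rvec p) (est S))"

text \<open>
  Since the estimator need not be measurable, ``with probability at least \<open>q\<close>'' refers to inner
  probability; for a measurable event it is \<open>measure M {x \<in> space M. P x} \<ge> q\<close>
  (see \<open>with_prob_at_least_iff\<close>).
\<close>

definition with_prob_at_least :: "'a measure \<Rightarrow> real \<Rightarrow> ('a \<Rightarrow> bool) \<Rightarrow> bool" where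
  "with_prob_at_least M q P \<longleftrightarrow> (\<exists>A\<in>sets M. A \<subseteq> {x \<in> space M. P x} \<and> measure M A \<ge> q)"

definition est_error :: "nat \<Rightarrow> vec \<Rightarrow> vec \<Rightarrow> real" where
  "est_error p b \<beta> = L2_set (\<lambda>i. b i - \<beta> i) {..<p}"

definition trunc_rate :: "nat \<Rightarrow> nat \<Rightarrow> real \<Rightarrow> real \<Rightarrow> real \<Rightarrow> ereal" where
  "trunc_rate n p \<epsilon> \<sigma> t =
     (if t = 0 then \<infinity>
      else ereal (\<sigma> / t * (sqrt (real p / real n) * exp (t\<^sup>2) + \<epsilon>)))"

definition adaptive_level :: "nat \<Rightarrow> nat \<Rightarrow> real \<Rightarrow> real" where
  "adaptive_level n p \<epsilon> = 1/2 * sqrt (ln (real n * \<epsilon>\<^sup>2 / real p + exp 1))"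

definition adaptive_rate :: "nat \<Rightarrow> nat \<Rightarrow> real \<Rightarrow> real \<Rightarrow> real" where
  "adaptive_rate n p \<epsilon> \<sigma> =
     \<sigma> * (sqrt (real p / real n) + \<epsilon> / sqrt (ln (real n * \<epsilon>\<^sup>2 / real p + exp 1)))"

lemma (in prob_space) with_prob_at_least_iff:
  assumes "{x \<in> space M. P x} \<in> sets M"
  shows "with_prob_at_least M q P \<longleftrightarrow> prob {x \<in> space M. P x} \<ge> q"
  unfolding with_prob_at_least_def using assms by (meson finite_measure_mono order.refl order.trans)

lemma space_borel_vec: "space (borel_vec p) = Rvec p"
  by (simp add: borel_vec_def Rvec_def space_PiM)

lemma sets_normal_law [measurable_cong]: "sets (normal_law m s) = sets borel"
  by (simp add: normal_law_def)

lemma prob_space_normal_law: "0 < s \<Longrightarrow> prob_space (normal_law m s)"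
  unfolding normal_law_def by (rule prob_space_normal_density)

lemma std_gaussian_vec_in: "std_gaussian_vec p \<in> space (prob_algebra (borel_vec p))"
proof -
  interpret product_prob_space "\<lambda>_. normal_law 0 1" "{..<p}"
    by (intro product_prob_spaceI prob_space_normal_law) simp
  show ?thesis
    by (auto simp: space_prob_algebra std_gaussian_vec_def borel_vec_def sets_normal_law
        intro!: sets_PiM_cong prob_space_axioms)
qed

lemma dotp_measurable [measurable]: "(\<lambda>x. dotp p x b) \<in> borel_measurable (borel_vec p)"
  unfolding dotp_def borel_vec_def by measurable

lemma normal_law_measurable:
  assumes "0 < s" "f \<in> borel_measurable M"
  shows "(\<lambda>x. normal_law (f x) s) \<in> M \<rightarrow>\<^sub>M prob_algebra borel"
proof (rule measurable_prob_algebraI)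
  show "prob_space (normal_law (f x) s)" for x
    using assms(1) by (rule prob_space_normal_law)
  note assms(2) [measurable]
  show "(\<lambda>x. normal_law (f x) s) \<in> M \<rightarrow>\<^sub>M subprob_algebra borel"
  proof (rule measurable_subprob_algebra)
    fix A :: "real set" assume [measurable]: "A \<in> sets borel"
    show "(\<lambda>x. emeasure (normal_law (f x) s) A) \<in> borel_measurable M"
      unfolding normal_law_def by (simp add: emeasure_density normal_density_def) measurable
  qed (auto simp: sets_normal_law intro!: prob_space_imp_subprob_space prob_space_normal_law assms(1))
qed

lemma response_law_measurable:
  assumes "adaptive_contamination_model n p \<epsilon> \<beta> \<sigma> Q"
  shows "response_law p \<epsilon> \<beta> \<sigma> Q \<in> borel_vec p \<rightarrow>\<^sub>M prob_algebra borel"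
proof -
  have Q [measurable]: "Q \<in> borel_vec p \<rightarrow>\<^sub>M prob_algebra borel"
    and N [measurable]: "(\<lambda>x. normal_law (dotp p x \<beta>) \<sigma>) \<in> borel_vec p \<rightarrow>\<^sub>M prob_algebra borel"
    using assms by (auto simp: adaptive_contamination_model_def intro!: normal_law_measurable)
  have B: "(\<lambda>_. measure_pmf (bernoulli_pmf \<epsilon>)) \<in> borel_vec p \<rightarrow>\<^sub>M prob_algebra (count_space UNIV)"
    by (intro measurable_const) (simp add: space_prob_algebra measure_pmf.prob_space_axioms)
  show ?thesis
    unfolding response_law_def [abs_def]
    by (rule measurable_bind_prob_space2 [OF B]) measurable
qed

lemma emeasure_response_law:
  assumes "adaptive_contamination_model n p \<epsilon> \<beta> \<sigma> Q" "x \<in> Rvec p" "A \<in> sets borel"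
  shows "emeasure (response_law p \<epsilon> \<beta> \<sigma> Q x) A =
    ennreal (1 - \<epsilon>) * emeasure (normal_law (dotp p x \<beta>) \<sigma>) A + ennreal \<epsilon> * emeasure (Q x) A"
proof -
  have Q: "Q x \<in> space (prob_algebra borel)"
    using assms by (auto simp: adaptive_contamination_model_def space_borel_vec dest: measurable_space)
  have N: "normal_law (dotp p x \<beta>) \<sigma> \<in> space (prob_algebra borel)"
    using assms by (simp add: adaptive_contamination_model_def space_prob_algebra sets_normal_law
        prob_space_normal_law)
  have K: "(\<lambda>b. if b then Q x else normal_law (dotp p x \<beta>) \<sigma>)
      \<in> count_space UNIV \<rightarrow>\<^sub>M prob_algebra borel"
    using Q N by auto
  have "emeasure (response_law p \<epsilon> \<beta> \<sigma> Q x) A =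
     (\<integral>\<^sup>+b. emeasure (if b then Q x else normal_law (dotp p x \<beta>) \<sigma>) A
        \<partial>measure_pmf (bernoulli_pmf \<epsilon>))"
    unfolding response_law_def
    by (rule emeasure_bind_prob_algebra [OF _ K assms(3)])
       (simp add: space_prob_algebra measure_pmf.prob_space_axioms)
  also have "\<dots> = ennreal (1 - \<epsilon>) * emeasure (normal_law (dotp p x \<beta>) \<sigma>) A
      + ennreal \<epsilon> * emeasure (Q x) A"
    using assms(1) by (simp add: adaptive_contamination_model_def ac_simps)
  finally show ?thesis .
qed

lemma obs_kernel_measurable:
  assumes "adaptive_contamination_model n p \<epsilon> \<beta> \<sigma> Q"
  shows "(\<lambda>x. response_law p \<epsilon> \<beta> \<sigma> Q x \<bind> (\<lambda>y. return (borel_vec p \<Otimes>\<^sub>M borel) (x, y)))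
    \<in> borel_vec p \<rightarrow>\<^sub>M prob_algebra (borel_vec p \<Otimes>\<^sub>M borel)"
  using response_law_measurable [OF assms] by measurable

lemma obs_law_in:
  assumes "adaptive_contamination_model n p \<epsilon> \<beta> \<sigma> Q"
  shows "obs_law p \<epsilon> \<beta> \<sigma> Q \<in> space (prob_algebra (borel_vec p \<Otimes>\<^sub>M borel))"
  unfolding obs_law_def space_prob_algebra
  using prob_space_bind' [OF std_gaussian_vec_in obs_kernel_measurable [OF assms]]
    sets_bind' [OF std_gaussian_vec_in obs_kernel_measurable [OF assms]]
  by simp

lemma emeasure_obs_law:
  assumes "adaptive_contamination_model n p \<epsilon> \<beta> \<sigma> Q"
    and A: "A \<in> sets (borel_vec p)" and B: "B \<in> sets borel"
  shows "emeasure (obs_law p \<epsilon> \<beta> \<sigma> Q) (A \<times> B) =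
    (\<integral>\<^sup>+x\<in>A. emeasure (response_law p \<epsilon> \<beta> \<sigma> Q x) B \<partial>std_gaussian_vec p)"
proof -
  have AB: "A \<times> B \<in> sets (borel_vec p \<Otimes>\<^sub>M borel)" using A B by simp
  have sp: "space (std_gaussian_vec p) = space (borel_vec p)"
    using std_gaussian_vec_in [of p] by (auto simp: space_prob_algebra dest: sets_eq_imp_space_eq)
  have R: "response_law p \<epsilon> \<beta> \<sigma> Q x \<in> space (prob_algebra borel)" if "x \<in> space (borel_vec p)" for x
    using measurable_space [OF response_law_measurable [OF assms(1)] that] .
  show ?thesis
    unfolding obs_law_def
    unfolding emeasure_bind_prob_algebra [OF std_gaussian_vec_in obs_kernel_measurable [OF assms(1)] AB]
  proof (intro nn_integral_cong)
    fix x assume "x \<in> space (std_gaussian_vec p)"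
    then have x: "x \<in> space (borel_vec p)" by (simp add: sp)
    have [measurable]: "(\<lambda>y. return (borel_vec p \<Otimes>\<^sub>M borel) (x, y))
        \<in> (borel :: real measure) \<rightarrow>\<^sub>M prob_algebra (borel_vec p \<Otimes>\<^sub>M borel)"
      using x by measurable
    have "emeasure (response_law p \<epsilon> \<beta> \<sigma> Q x \<bind> (\<lambda>y. return (borel_vec p \<Otimes>\<^sub>M borel) (x, y))) (A \<times> B)
        = (\<integral>\<^sup>+y. emeasure (return (borel_vec p \<Otimes>\<^sub>M borel) (x, y)) (A \<times> B) \<partial>response_law p \<epsilon> \<beta> \<sigma> Q x)"
      by (rule emeasure_bind_prob_algebra [OF R [OF x] _ AB]) measurable
    also have "\<dots> = (\<integral>\<^sup>+y. indicator A x * indicator B y \<partial>response_law p \<epsilon> \<beta> \<sigma> Q x)"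
      using AB by (simp add: indicator_times)
    also have "\<dots> = emeasure (response_law p \<epsilon> \<beta> \<sigma> Q x) B * indicator A x"
    proof -
      have "B \<in> sets (response_law p \<epsilon> \<beta> \<sigma> Q x)"
        using R [OF x] B by (simp add: space_prob_algebra)
      then show ?thesis
        by (subst nn_integral_cmult) (auto simp: mult.commute)
    qed
    finally show "emeasure (response_law p \<epsilon> \<beta> \<sigma> Q x \<bind> (\<lambda>y. return (borel_vec p \<Otimes>\<^sub>M borel) (x, y))) (A \<times> B)
      = emeasure (response_law p \<epsilon> \<beta> \<sigma> Q x) B * indicator A x" .
  qed
qed

lemma prob_space_sample_law:
  assumes "adaptive_contamination_model n p \<epsilon> \<beta> \<sigma> Q"
  shows "prob_space (sample_law n p \<epsilon> \<beta> \<sigma> Q)"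
  unfolding sample_law_def using obs_law_in [OF assms]
  by (intro prob_space_PiM) (simp add: space_prob_algebra)

lemma space_sample_law:
  assumes "adaptive_contamination_model n p \<epsilon> \<beta> \<sigma> Q"
  shows "space (sample_law n p \<epsilon> \<beta> \<sigma> Q) = {..<n} \<rightarrow>\<^sub>E (Rvec p \<times> UNIV)"
proof -
  have "space (obs_law p \<epsilon> \<beta> \<sigma> Q) = Rvec p \<times> UNIV"
    using obs_law_in [OF assms]
    by (auto simp: space_prob_algebra space_pair_measure space_borel_vec dest: sets_eq_imp_space_eq)
  then show ?thesis by (simp add: sample_law_def space_PiM)
qed

end

theory Submission
  imports Defs
begin

text \<open>
  At a point \<open>b\<close> at distance more than \<open>e\<close> from \<open>\<beta>\<close>, test the depth in the direction of \<open>b - \<beta>\<close>: every counted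
  observation then has a residual at \<open>\<beta>\<close> of size at least \<open>e t\<close>, with the sign of the projected
  covariate. So the depth at \<open>b\<close> is at most the empirical mass of a half space \<open>v \<bullet> W \<ge> t\<close>, where
  \<open>W\<close> is the covariate multiplied by the truncated sign of the residual at \<open>\<beta>\<close>; the depth at \<open>\<beta>\<close> is at least
  the smallest empirical mass of such half spaces, with untruncated signs. The quadratic
  family of depth events is thus replaced by two families of half spaces, with population masses
  at most \<open>2 G(t) (G(e t / \<sigma>) + \<epsilon>)\<close> and at least \<open>(1 - \<epsilon>) G(t)\<close>, where \<open>G\<close> is the Gaussian tail.
  Since \<open>G(t) exp (t\<^sup>2)\<close> is bounded below, it remains to bound the empirical deviations by a
  multiple of \<open>sqrt (p / n)\<close>, without a logarithmic factor. This is done by chaining along grid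
  roundings of the sphere at scales \<open>1 / 16 ^ k\<close> with Bernstein's inequality at each
  level, stopping at scale \<open>p / n\<close>, where the remainder is controlled by thin Gaussian bands and by
  \<open>sup\<^sub>u (1/n) \<Sum>\<^sub>i \<bar>u \<bullet> X\<^sub>i\<bar>\<close>.
\<close>

section \<open>Exponential bounds for i.i.d. sums\<close>

text \<open>The obstacle to chaining is that a half space indicator is not Lipschitz in its
  direction. Moving the direction by \<open>d\<close> flips only points in a band of half-width
  \<open>a\<close> about the boundary, or points whose projection changes by at least
  \<open>a\<close>; for directions of norm at least \<open>1/2\<close> this has probability at most
  \<open>4 a + d / a\<close>. The balanced choice is \<open>a = sqrt d\<close>, so scales
  \<open>1 / 16 ^ k\<close> yield variances of order \<open>1 / 4 ^ k\<close>, against families of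
  size exponential in \<open>k p\<close>. The square-root terms in Bernstein's inequality are then
  summable, and the linear ones cost only \<open>p / n\<close> times the squared number of levels,
  which is logarithmic in \<open>n / p\<close>. The range
  \<open>t\<^sup>2 \<le> 0.4 ln (n / p)\<close> means that \<open>exp (- t\<^sup>2)\<close> is at
  least \<open>r ^ (4/5)\<close> for \<open>r = sqrt (p / n)\<close>, so the empirical error of
  order \<open>r\<close> is dominated once \<open>r ^ (1/5)\<close> is small. This is the origin of
  the fifth power in the smallness threshold. The good events are built from finite nets and do not
  mention the estimator. They are therefore measurable and serve every selection of maximizers at
  once.\<close>

lemma iid_chernoff:
  fixes f :: "'a \<Rightarrow> real" and n :: nat
  assumes "prob_space \<mu>" and f [measurable]: "f \<in> borel_measurable \<mu>"
    and le: "(\<integral>\<^sup>+x. ennreal (exp (f x)) \<partial>\<mu>) \<le> ennreal (exp c)"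
  shows "measure (\<Pi>\<^sub>M i\<in>{..<n}. \<mu>) {S \<in> space (\<Pi>\<^sub>M i\<in>{..<n}. \<mu>). s \<le> (\<Sum>i<n. f (S i))}
    \<le> exp (real n * c - s)"
proof -
  let ?M = "\<Pi>\<^sub>M i\<in>{..<n}. \<mu>"
  interpret \<mu>: prob_space \<mu> by fact
  interpret product_sigma_finite "\<lambda>_::nat. \<mu>" by standard
  interpret M: prob_space ?M by (intro prob_space_PiM \<mu>.prob_space_axioms)
  have "emeasure ?M {S \<in> space ?M. s \<le> (\<Sum>i<n. f (S i))}
      = emeasure ?M ({S \<in> space ?M. 1 \<le> ennreal (exp (- s)) * (\<Prod>i<n. ennreal (exp (f (S i))))} \<inter> space ?M)"
  proof -
    have "s \<le> x \<longleftrightarrow> 1 \<le> ennreal (exp (- s)) * ennreal (exp x)" for x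
      by (simp flip: exp_add ennreal_mult add: ennreal_le_iff flip: ennreal_1)
    then show ?thesis
      by (intro arg_cong2[where f = emeasure] refl) (auto simp: prod_ennreal exp_sum)
  qed
  also have "\<dots> \<le> ennreal (exp (- s)) * (\<integral>\<^sup>+S. (\<Prod>i<n. ennreal (exp (f (S i)))) * indicator (space ?M) S \<partial>?M)"
    by (rule order.trans[OF _ nn_integral_Markov_inequality]) (auto intro!: emeasure_mono)
  also have "(\<integral>\<^sup>+S. (\<Prod>i<n. ennreal (exp (f (S i)))) * indicator (space ?M) S \<partial>?M)
      = (\<integral>\<^sup>+S. (\<Prod>i<n. ennreal (exp (f (S i)))) \<partial>?M)"
    by (intro nn_integral_cong) auto
  also have "\<dots> = (\<integral>\<^sup>+x. ennreal (exp (f x)) \<partial>\<mu>) ^ n"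
    by (subst product_nn_integral_prod) auto
  also have "ennreal (exp (- s)) * \<dots> \<le> ennreal (exp (- s)) * ennreal (exp c) ^ n"
    by (intro mult_left_mono power_mono le) auto
  also have "\<dots> = ennreal (exp (real n * c - s))"
    by (simp add: ennreal_power exp_of_nat_mult flip: ennreal_mult) (simp add: exp_diff exp_minus field_simps flip: exp_of_nat2_mult)
  finally show ?thesis
    by (simp add: M.emeasure_eq_measure)
qed

text \<open>For negative \<open>x\<close> the quotient
  \<open>(1 + x + x\<^sup>2) * exp (- x)\<close> is monotone: its derivative
  \<open>(x - x\<^sup>2) * exp (- x)\<close> is nonpositive up to \<open>0\<close>, where the
  quotient equals 1.\<close>

lemma exp_le_quadratic:
  fixes x :: real
  assumes "x \<le> 1"
  shows "exp x \<le> 1 + x + x\<^sup>2"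
proof (cases "0 \<le> x")
  case True
  then show ?thesis using exp_bound[of x] assms by simp
next
  case False
  define g where "g = (\<lambda>x::real. (1 + x + x\<^sup>2) * exp (- x))"
  have "g 0 \<le> g x"
  proof (rule DERIV_nonpos_imp_nonincreasing[of x 0 g])
    show "x \<le> 0" using False by simp
    fix y :: real assume y: "x \<le> y" "y \<le> 0"
    have "(g has_real_derivative (y - y\<^sup>2) * exp (- y)) (at y)"
      unfolding g_def by (auto intro!: derivative_eq_intros simp: algebra_simps power2_eq_square)
    moreover have "(y - y\<^sup>2) * exp (- y) \<le> 0"
      using y by (intro mult_nonpos_nonneg) (auto simp: power2_eq_square intro: order.trans)
    ultimately show "\<exists>d. (g has_real_derivative d) (at y) \<and> d \<le> 0" by blast
  qed
  then show ?thesis by (simp add: g_def exp_minus field_simps)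
qed

text \<open>The Chernoff bound for \<open>l * f\<close>, with log moment generating function at most
  \<open>l * m + l\<^sup>2 * q\<close> for the mean \<open>m\<close>. The quadratic estimate of
  \<open>exp\<close> restricts \<open>l\<close> to at most 1, and the linear term
  \<open>2 * \<tau>\<close> is the price. Since \<open>q\<close> is just an upper bound, one
  deviation serves a whole family.\<close>

lemma iid_bernstein:
  fixes f :: "'a \<Rightarrow> real" and n :: nat
  assumes \<mu>: "prob_space \<mu>" and f [measurable]: "f \<in> borel_measurable \<mu>"
    and bd: "\<And>x. \<bar>f x\<bar> \<le> 1" and q: "(\<integral>x. (f x)\<^sup>2 \<partial>\<mu>) \<le> q" and \<tau>: "0 < \<tau>" and n: "0 < n"
  shows "measure (\<Pi>\<^sub>M i\<in>{..<n}. \<mu>) {S \<in> space (\<Pi>\<^sub>M i\<in>{..<n}. \<mu>).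
      real n * (\<integral>x. f x \<partial>\<mu>) + (2 * sqrt (real n * q * \<tau>) + 2 * \<tau>) \<le> (\<Sum>i<n. f (S i))} \<le> exp (- \<tau>)"
proof -
  interpret \<mu>: prob_space \<mu> by fact
  have int: "integrable \<mu> f" "integrable \<mu> (\<lambda>x. (f x)\<^sup>2)"
    using bd by (auto intro!: \<mu>.integrable_const_bound[where B = 1] simp: power_le_one abs_square_le_1)
  have q0: "0 \<le> q" using q by (rule order.trans[rotated]) simp
  let ?m = "\<integral>x. f x \<partial>\<mu>" and ?s = "2 * sqrt (real n * q * \<tau>) + 2 * \<tau>"
  \<comment> \<open>The unconstrained optimum is \<open>sqrt (\<tau> / (n q))\<close>. If
    \<open>n q \<le> \<tau>\<close> it is not admissible as a value below 1, and
    \<open>l = 1\<close> works because \<open>2 * \<tau>\<close> pays for both summands on the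
    left.\<close>
  obtain l where l: "0 < l" "l \<le> 1" "\<tau> + real n * q * l\<^sup>2 \<le> l * ?s"
  proof (cases "real n * q \<le> \<tau>")
    case True
    have "0 \<le> sqrt (real n * q * \<tau>)" using \<tau> q0 by (intro real_sqrt_ge_zero mult_nonneg_nonneg) auto
    then have "\<tau> + real n * q * 1\<^sup>2 \<le> 1 * ?s"
      unfolding power_one mult_1_right mult_1_left using True \<tau> by linarith
    then show ?thesis by (intro that[of 1]) auto
  next
    case False
    then have nq: "0 < real n * q" using \<tau> by linarith
    then have "q \<noteq> 0" by auto
    let ?l = "sqrt (\<tau> / (real n * q))"
    have "?l * sqrt (real n * q * \<tau>) = \<tau>"
    proof -
      have "?l * sqrt (real n * q * \<tau>) = sqrt (\<tau>\<^sup>2)"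
        unfolding real_sqrt_mult[symmetric] using nq n \<open>q \<noteq> 0\<close> by (intro arg_cong[where f = sqrt]) (simp add: power2_eq_square)
      then show ?thesis using \<tau> by simp
    qed
    moreover have "?l\<^sup>2 * (real n * q) = \<tau>" using nq \<tau> n \<open>q \<noteq> 0\<close> by simp
    moreover have "0 < ?l" using nq \<tau> by simp
    ultimately show ?thesis using False \<tau> nq
      by (intro that[of ?l]) (auto simp: algebra_simps)
  qed
  have "(\<integral>\<^sup>+x. ennreal (exp (l * f x)) \<partial>\<mu>) \<le> (\<integral>\<^sup>+x. ennreal (1 + l * f x + l\<^sup>2 * (f x)\<^sup>2) \<partial>\<mu>)"
  proof (intro nn_integral_mono ennreal_leI)
    fix x
    have "l * f x \<le> l * 1" using bd[of x] l by (intro mult_left_mono) (auto simp: abs_le_iff)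
    then have "l * f x \<le> 1" unfolding mult_1_right using l(2) by (rule order.trans)
    then show "exp (l * f x) \<le> 1 + l * f x + l\<^sup>2 * (f x)\<^sup>2"
      using exp_le_quadratic[of "l * f x"] by (simp add: power_mult_distrib)
  qed
  also have "\<dots> = ennreal (\<integral>x. 1 + l * f x + l\<^sup>2 * (f x)\<^sup>2 \<partial>\<mu>)"
  proof (intro nn_integral_eq_integral AE_I2)
    show "integrable \<mu> (\<lambda>x. 1 + l * f x + l\<^sup>2 * (f x)\<^sup>2)" using int by simp
    fix x
    have "\<bar>l * f x\<bar> \<le> 1" using bd[of x] l by (auto simp: abs_mult intro: mult_le_one)
    then show "0 \<le> 1 + l * f x + l\<^sup>2 * (f x)\<^sup>2"
      using zero_le_mult_iff[of "l\<^sup>2" "(f x)\<^sup>2"] by (simp add: abs_le_iff)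
  qed
  also have "(\<integral>x. 1 + l * f x + l\<^sup>2 * (f x)\<^sup>2 \<partial>\<mu>) = 1 + (l * ?m + l\<^sup>2 * (\<integral>x. (f x)\<^sup>2 \<partial>\<mu>))"
    using int by (simp add: \<mu>.prob_space)
  also have "\<dots> \<le> exp (l * ?m + l\<^sup>2 * (\<integral>x. (f x)\<^sup>2 \<partial>\<mu>))" by (rule exp_ge_add_one_self)
  also have "\<dots> \<le> exp (l * ?m + l\<^sup>2 * q)" using q by (auto intro: mult_left_mono)
  finally have mgf: "(\<integral>\<^sup>+x. ennreal (exp (l * f x)) \<partial>\<mu>) \<le> ennreal (exp (l * ?m + l\<^sup>2 * q))"
    by (simp add: ennreal_leI)
  have "real n * ?m + ?s \<le> x \<longleftrightarrow> l * (real n * ?m + ?s) \<le> l * x" for x using l by simp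
  then have "measure (\<Pi>\<^sub>M i\<in>{..<n}. \<mu>) {S \<in> space (\<Pi>\<^sub>M i\<in>{..<n}. \<mu>). real n * ?m + ?s \<le> (\<Sum>i<n. f (S i))}
    = measure (\<Pi>\<^sub>M i\<in>{..<n}. \<mu>) {S \<in> space (\<Pi>\<^sub>M i\<in>{..<n}. \<mu>). l * (real n * ?m + ?s) \<le> (\<Sum>i<n. l * f (S i))}"
    by (simp add: sum_distrib_left)
  also have "\<dots> \<le> exp (real n * (l * ?m + l\<^sup>2 * q) - l * (real n * ?m + ?s))"
    by (rule iid_chernoff[OF \<mu> _ mgf]) measurable
  also have "\<dots> \<le> exp (- \<tau>)" using l(3) by (simp add: algebra_simps)
  finally show ?thesis .
qed

section \<open>Grid nets of the unit sphere\<close>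

text \<open>With \<open>x = exp (- 1 / R)\<close> each side contributes at most
  \<open>x / (1 - x)\<close>, and \<open>1 + 1 / R \<le> exp (1 / R)\<close> bounds this by
  \<open>R\<close>.\<close>

lemma geometric_two_sided_le:
  fixes R :: real and m :: nat
  assumes "0 < R"
  shows "(\<Sum>j=-int m..int m. exp (- real_of_int \<bar>j\<bar> / R)) \<le> 1 + 2 * R"
proof -
  let ?x = "exp (- 1 / R)" and ?f = "\<lambda>j::int. exp (- real_of_int \<bar>j\<bar> / R)"
  have x: "0 < ?x" "?x < 1" using assms by auto
  have "1 + 1 / R \<le> exp (1 / R)" by (rule exp_ge_add_one_self)
  then have "?x * (1 + 1 / R) \<le> ?x * exp (1 / R)" by (intro mult_left_mono) auto
  also have "?x * exp (1 / R) = 1" by (simp flip: exp_add)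
  finally have xR: "?x / (1 - ?x) \<le> R" using assms x by (simp add: field_simps)
  have e: "?f (int k) = ?x ^ k" "?f (- int k) = ?x ^ k" for k
    by (simp_all flip: exp_of_nat_mult)
  have "(\<Sum>j=-int m..int m. ?f j) = 1 + 2 * (\<Sum>k=1..m. ?x ^ k)"
  proof (induction m)
    case (Suc m)
    have "{-int (Suc m)..int (Suc m)} = insert (- int (Suc m)) (insert (int (Suc m)) {-int m..int m})"
      by auto
    moreover have "- int (Suc m) \<notin> insert (int (Suc m)) {-int m..int m}" "int (Suc m) \<notin> {-int m..int m}"
      by auto
    ultimately have "(\<Sum>j=-int (Suc m)..int (Suc m). ?f j)
        = ?f (- int (Suc m)) + (?f (int (Suc m)) + (\<Sum>j=-int m..int m. ?f j))"
      by (simp only: sum.insert finite_insert finite_atLeastAtMost_int not_False_eq_True simp_thms)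
    then show ?case unfolding e Suc.IH by simp
  qed simp
  also have "(\<Sum>k=1..m. ?x ^ k) \<le> ?x / (1 - ?x)"
  proof -
    have "(\<Sum>k=1..m. ?x ^ k) = ?x * (\<Sum>k<m. ?x ^ k)"
      by (simp add: sum_distrib_left sum.atLeast1_atMost_eq)
    also have "(\<Sum>k<m. ?x ^ k) \<le> 1 / (1 - ?x)"
      using x by (subst sum_gp_strict) (auto simp: divide_right_mono)
    finally show ?thesis using x by (simp add: mult_left_mono)
  qed
  finally show ?thesis using xR by linarith
qed

text \<open>Exponential weights \<open>exp (p - \<parallel>z\<parallel>\<^sub>1 / R) \<ge> 1\<close> on the \<open>\<ell>\<^sub>1\<close> ball turn the count into a product of
  one-dimensional geometric sums.\<close>

lemma card_int_l1_ball:
  fixes R :: real and p :: nat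
  assumes R: "0 < R"
  defines "Z \<equiv> {z \<in> {..<p} \<rightarrow>\<^sub>E (UNIV :: int set). (\<Sum>i<p. real_of_int \<bar>z i\<bar>) \<le> real p * R}"
  shows "finite Z" and "real (card Z) \<le> (exp 1 * (1 + 2 * R)) ^ p"
proof -
  define m where "m = nat \<lfloor>real p * R\<rfloor>"
  let ?E = "{..<p} \<rightarrow>\<^sub>E {-int m..int m}"
  have sub: "Z \<subseteq> ?E"
  proof (intro subsetI PiE_I)
    fix z assume z: "z \<in> Z"
    show "z i = undefined" if "i \<notin> {..<p}" for i
      using z that by (auto simp: Z_def PiE_iff extensional_def)
    show "z i \<in> {-int m..int m}" if "i \<in> {..<p}" for i
    proof -
      have "real_of_int \<bar>z i\<bar> \<le> (\<Sum>i<p. real_of_int \<bar>z i\<bar>)"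
        using that by (intro member_le_sum[of i "{..<p}" "\<lambda>i. real_of_int \<bar>z i\<bar>"]) auto
      also have "\<dots> \<le> real p * R" using z by (simp add: Z_def)
      finally have "\<bar>z i\<bar> \<le> int m" using R unfolding m_def by (simp add: le_floor_iff)
      then show ?thesis by (simp add: abs_le_iff)
    qed
  qed
  have fE: "finite ?E" by (intro finite_PiE) auto
  then show "finite Z" using sub finite_subset by blast
  have "real (card Z) = (\<Sum>z\<in>Z. 1)" by simp
  also have "\<dots> \<le> (\<Sum>z\<in>Z. exp (real p - (\<Sum>i<p. real_of_int \<bar>z i\<bar>) / R))"
    using R by (intro sum_mono) (auto simp: Z_def divide_simps mult.commute)
  also have "\<dots> \<le> (\<Sum>z\<in>?E. exp (real p - (\<Sum>i<p. real_of_int \<bar>z i\<bar>) / R))"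
    by (intro sum_mono2 fE sub) auto
  also have "\<dots> = exp 1 ^ p * (\<Sum>z\<in>?E. \<Prod>i<p. exp (- real_of_int \<bar>z i\<bar> / R))"
    by (simp add: exp_diff sum_distrib_left exp_minus sum_divide_distrib exp_sum inverse_eq_divide prod_dividef
        flip: exp_of_nat_mult)
  also have "(\<Sum>z\<in>?E. \<Prod>i<p. exp (- real_of_int \<bar>z i\<bar> / R)) = (\<Prod>i<p. \<Sum>j=-int m..int m. exp (- real_of_int \<bar>j\<bar> / R))"
    by (subst prod_sum_PiE) auto
  also have "\<dots> = (\<Sum>j=-int m..int m. exp (- real_of_int \<bar>j\<bar> / R)) ^ p" by simp
  also have "exp 1 ^ p * \<dots> \<le> exp 1 ^ p * (1 + 2 * R) ^ p"
    using geometric_two_sided_le[OF R, of m] by (intro mult_left_mono power_mono sum_nonneg) auto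
  finally show "real (card Z) \<le> (exp 1 * (1 + 2 * R)) ^ p" by (simp add: power_mult_distrib)
qed

text \<open>The factor \<open>sqrt p\<close> in the mesh makes the Euclidean error at most
  \<open>1 / 16 ^ k\<close> in every dimension. Rounded points leave the sphere, so half spaces are
  later indexed by vectors whose norm is merely close to 1.\<close>

definition grid_round :: "nat \<Rightarrow> nat \<Rightarrow> vec \<Rightarrow> vec" where
  "grid_round p k v = (\<lambda>i\<in>{..<p}. real_of_int \<lfloor>v i * (16 ^ k * sqrt (real p))\<rfloor> / (16 ^ k * sqrt (real p)))"

definition sphere_net :: "nat \<Rightarrow> nat \<Rightarrow> vec set" where
  "sphere_net p k = grid_round p k ` unit_sphere p"

definition vnorm :: "nat \<Rightarrow> vec \<Rightarrow> real" where
  "vnorm p v = L2_set v {..<p}"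

definition vsub :: "nat \<Rightarrow> vec \<Rightarrow> vec \<Rightarrow> vec" where
  "vsub p u v = (\<lambda>i\<in>{..<p}. u i - v i)"

lemma vnorm_nonneg [simp]: "0 \<le> vnorm p v"
  by (simp add: vnorm_def)

lemma vnorm_vsub: "vnorm p (vsub p u v) = L2_set (\<lambda>i. u i - v i) {..<p}"
  unfolding vnorm_def vsub_def by (intro L2_set_cong) auto

lemma vnorm_vsub_commute: "vnorm p (vsub p u v) = vnorm p (vsub p v u)"
  unfolding vnorm_vsub by (simp add: L2_set_def power2_commute)

lemma vnorm_triangle_sub: "vnorm p u \<le> vnorm p v + vnorm p (vsub p u v)"
  using L2_set_triangle_ineq[of v "\<lambda>i. u i - v i" "{..<p}"]
  by (simp add: vnorm_vsub) (simp add: vnorm_def)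

lemma vnorm_vsub_triangle: "vnorm p (vsub p u w) \<le> vnorm p (vsub p u v) + vnorm p (vsub p v w)"
  using L2_set_triangle_ineq[of "\<lambda>i. u i - v i" "\<lambda>i. v i - w i" "{..<p}"]
  by (simp add: vnorm_vsub)

lemma dotp_measurable_left [measurable]: "dotp p w \<in> borel_measurable (borel_vec p)"
  unfolding dotp_def borel_vec_def by measurable

lemma dotp_vsub: "dotp p (vsub p u v) x = dotp p u x - dotp p v x"
  by (simp add: dotp_def vsub_def left_diff_distrib sum_subtractf)

lemma vnorm_grid_round_le:
  "vnorm p (vsub p v (grid_round p k v)) \<le> 1 / 16 ^ k"
proof (cases "p = 0")
  case False
  let ?s = "16 ^ k * sqrt (real p)"
  have s: "0 < ?s" using False by simp
  have "vnorm p (vsub p v (grid_round p k v)) \<le> L2_set (\<lambda>i. 1 / ?s) {..<p}"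
  proof -
    have "vnorm p (vsub p v (grid_round p k v)) = L2_set (\<lambda>i. v i - real_of_int \<lfloor>v i * ?s\<rfloor> / ?s) {..<p}"
      unfolding vnorm_vsub by (intro L2_set_cong) (auto simp: grid_round_def)
    also have "\<dots> \<le> L2_set (\<lambda>i. 1 / ?s) {..<p}"
    proof (intro L2_set_mono)
      fix i
      have "v i - real_of_int \<lfloor>v i * ?s\<rfloor> / ?s = (v i * ?s - real_of_int \<lfloor>v i * ?s\<rfloor>) / ?s"
        using s False by (simp add: diff_divide_distrib)
      moreover have "0 \<le> v i * ?s - real_of_int \<lfloor>v i * ?s\<rfloor>" "v i * ?s - real_of_int \<lfloor>v i * ?s\<rfloor> \<le> 1"
        by linarith+
      ultimately show "0 \<le> v i - real_of_int \<lfloor>v i * ?s\<rfloor> / ?s" "v i - real_of_int \<lfloor>v i * ?s\<rfloor> / ?s \<le> 1 / ?s"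
        using s by (auto intro: divide_right_mono)
    qed
    finally show ?thesis .
  qed
  also have "\<dots> = 1 / 16 ^ k"
    using False by (simp add: L2_set_def power_divide power_mult_distrib real_sqrt_divide real_sqrt_mult)
  finally show ?thesis .
qed (simp add: vnorm_def)

lemma vnorm_grid_round_bounds:
  assumes "v \<in> unit_sphere p"
  shows "1 - 1 / 16 ^ k \<le> vnorm p (grid_round p k v)" "vnorm p (grid_round p k v) \<le> 1 + 1 / 16 ^ k"
proof -
  have "vnorm p v = 1" using assms by (simp add: unit_sphere_def vnorm_def)
  then show "1 - 1 / 16 ^ k \<le> vnorm p (grid_round p k v)" "vnorm p (grid_round p k v) \<le> 1 + 1 / 16 ^ k"
    using vnorm_grid_round_le[of p v k] vnorm_triangle_sub[of p v "grid_round p k v"]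
      vnorm_triangle_sub[of p "grid_round p k v" v] by (auto simp: vnorm_vsub_commute)
qed

lemma sum_abs_le_vnorm: "(\<Sum>i<p. \<bar>v i\<bar>) \<le> sqrt (real p) * vnorm p v"
  using L2_set_mult_ineq[of v "\<lambda>_. 1" "{..<p}"]
  by (simp add: vnorm_def L2_set_def mult.commute)

text \<open>After scaling, net points are integer vectors, and Cauchy-Schwarz bounds their l1 norm
  by \<open>p * (16 ^ k + 1)\<close>. Using the coordinatewise bound of order
  \<open>16 ^ k * sqrt p\<close> instead would put \<open>p * ln p\<close> into the exponent and
  spoil the rate.\<close>

lemma sphere_net_card:
  assumes p: "1 \<le> p"
  shows "finite (sphere_net p k)" and "real (card (sphere_net p k)) \<le> exp (3 * (real k + 1) * real p)"
proof -
  let ?s = "16 ^ k * sqrt (real p)" and ?R = "16 ^ k + 1 :: real"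
  define Z where "Z = {z \<in> {..<p} \<rightarrow>\<^sub>E (UNIV :: int set). (\<Sum>i<p. real_of_int \<bar>z i\<bar>) \<le> real p * ?R}"
  define g where "g = (\<lambda>z::nat \<Rightarrow> int. \<lambda>i\<in>{..<p}. real_of_int (z i) / ?s)"
  have s: "0 < ?s" using p by simp
  have sub: "sphere_net p k \<subseteq> g ` Z"
  proof
    fix w assume "w \<in> sphere_net p k"
    then obtain v where v: "v \<in> unit_sphere p" "w = grid_round p k v" by (auto simp: sphere_net_def)
    define z where "z = (\<lambda>i\<in>{..<p}. \<lfloor>v i * ?s\<rfloor>)"
    have w: "w = g z" by (auto simp: v grid_round_def g_def z_def fun_eq_iff)
    have "(\<Sum>i<p. real_of_int \<bar>z i\<bar>) = ?s * (\<Sum>i<p. \<bar>w i\<bar>)"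
      using s unfolding w by (auto simp: g_def sum_distrib_left intro!: sum.cong)
    also have "\<dots> \<le> ?s * (sqrt (real p) * (1 + 1 / 16 ^ k))"
      using s vnorm_grid_round_bounds[OF v(1), of k] v(2)
      by (intro mult_left_mono order.trans[OF sum_abs_le_vnorm]) auto
    also have "\<dots> = (sqrt (real p) * sqrt (real p)) * ?R"
      by (simp add: distrib_left mult.assoc mult.left_commute[of "sqrt (real p)"])
    also have "sqrt (real p) * sqrt (real p) = real p" by simp
    finally have "z \<in> Z" by (simp add: Z_def z_def)
    then show "w \<in> g ` Z" using w by blast
  qed
  have fZ: "finite Z" and cZ: "real (card Z) \<le> (exp 1 * (1 + 2 * ?R)) ^ p"
    unfolding Z_def using card_int_l1_ball[of ?R p] by (simp_all add: add_pos_pos)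
  show "finite (sphere_net p k)" using sub fZ finite_surj by blast
  have "real (card (sphere_net p k)) \<le> real (card Z)"
    using surj_card_le[OF fZ sub] by simp
  also note cZ
  also have "(exp 1 * (1 + 2 * ?R)) ^ p \<le> (exp (3 * (real k + 1))) ^ p"
  proof (rule power_mono)
    \<comment> \<open>The constant 3 in the exponent arises here: the base of the count is at most
      \<open>15 * 16 ^ k\<close>, and 16 is below \<open>exp 3\<close> because
      \<open>1.625 ^ 6\<close> exceeds 16.\<close>
    have "(2::real) ^ 4 \<le> exp 3"
    proof -
      have "1 + 1/2 + (1/2)\<^sup>2 / 2 \<le> exp (1/2::real)" using exp_lower_Taylor_quadratic[of "1/2::real"] by simp
      then have "(1.625::real) ^ 6 \<le> exp (1/2) ^ 6" by (intro power_mono) (auto simp: power2_eq_square)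
      also have "exp (1/2::real) ^ 6 = exp 3" by (simp flip: exp_of_nat_mult)
      finally show ?thesis by (simp add: eval_nat_numeral)
    qed
    then have "(16::real) ^ (k + 1) \<le> exp 3 ^ (k + 1)" by (intro power_mono) auto
    also have "\<dots> = exp (3 * (real k + 1))" by (simp flip: exp_of_nat_mult exp_add add: algebra_simps)
    finally have A: "16 * (16::real) ^ k \<le> exp (3 * (real k + 1))" by simp
    have "exp 1 * (1 + 2 * ?R) \<le> 3 * (5 * 16 ^ k)"
      using exp_le by (intro mult_mono) auto
    with A show "exp 1 * (1 + 2 * ?R) \<le> exp (3 * (real k + 1))"
      using zero_less_power[of "16::real" k] by linarith
    show "0 \<le> exp 1 * (1 + 2 * ?R)" by (auto intro!: mult_nonneg_nonneg add_nonneg_nonneg)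
  qed
  also have "\<dots> = exp (3 * (real k + 1) * real p)" by (simp flip: exp_of_nat2_mult)
  finally show "real (card (sphere_net p k)) \<le> exp (3 * (real k + 1) * real p)" .
qed

section \<open>Gaussian projections and tails\<close>

lemma space_normal_law [simp]: "space (normal_law m s) = UNIV"
  by (simp add: normal_law_def)

lemma sets_std_gaussian_vec [measurable_cong]: "sets (std_gaussian_vec p) = sets (borel_vec p)"
  using std_gaussian_vec_in [of p] by (simp add: space_prob_algebra)

lemma space_std_gaussian_vec: "space (std_gaussian_vec p) = Rvec p"
  using sets_eq_imp_space_eq[OF sets_std_gaussian_vec] by (simp add: space_borel_vec)

lemma std_normal_distributed_id:
  "distributed (normal_law 0 1) lborel (\<lambda>x. x) (\<lambda>x. ennreal (normal_density 0 1 x))"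
  unfolding distributed_def
proof (intro conjI)
  show "distr (normal_law 0 1) lborel (\<lambda>x. x) = density lborel (\<lambda>x. ennreal (normal_density 0 1 x))"
    by (subst distr_id2) (simp_all add: normal_law_def)
qed (auto simp: normal_law_def)

lemma normal_law_affine:
  assumes "0 < s"
  shows "normal_law m s = distr (normal_law 0 1) borel (\<lambda>x. m + s * x)"
proof -
  interpret prob_space "normal_law 0 1" by (rule prob_space_normal_law) simp
  from normal_density_affine[OF std_normal_distributed_id, of s m] assms
  show ?thesis unfolding distributed_def normal_law_def
    by (simp add: distr_cong[OF refl sets_lborel])
qed

lemma dotp_std_gaussian:
  assumes w: "0 < vnorm p w"
  shows "distr (std_gaussian_vec p) borel (dotp p w) = normal_law 0 (vnorm p w)"
proof -
  define M where "M = std_gaussian_vec p"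
  have ps: "prob_space (normal_law 0 1)" by (rule prob_space_normal_law) simp
  interpret M: prob_space M
    unfolding M_def std_gaussian_vec_def by (intro prob_space_PiM ps)
  \<comment> \<open>Coordinates of weight 0 are dropped because the sum rule for independent normal
    variables asks for positive standard deviations.\<close>
  define I where "I = {i. i < p \<and> w i \<noteq> 0}"
  have I: "finite I" "I \<subseteq> {..<p}" by (auto simp: I_def)
  have p: "{..<p} \<noteq> {}" using w by (auto simp: vnorm_def)
  have vn: "vnorm p w = sqrt (\<Sum>i\<in>I. \<bar>w i\<bar>\<^sup>2)"
    unfolding vnorm_def L2_set_def I_def by (intro arg_cong[where f = sqrt] sum.mono_neutral_cong_right) auto
  have "I \<noteq> {}" using w by (auto simp: vn)
  have meas: "(\<lambda>x. x i) \<in> borel_measurable M" if "i < p" for i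
    unfolding M_def std_gaussian_vec_def using that
    by (subst measurable_cong_sets[OF refl sets_normal_law[of 0 1, symmetric]]) (intro measurable_component_singleton, simp)
  have comp: "distr M borel (\<lambda>x. x i) = normal_law 0 1" if "i < p" for i
  proof -
    have "distr M borel (\<lambda>x. x i) = distr M (normal_law 0 1) (\<lambda>x. x i)"
      by (intro distr_cong) (auto simp: sets_normal_law)
    also have "\<dots> = normal_law 0 1"
      unfolding M_def std_gaussian_vec_def using that by (intro distr_PiM_component ps) auto
    finally show ?thesis .
  qed
  have "M.indep_vars (\<lambda>_. borel) (\<lambda>i x. x i) {..<p}"
  proof (subst M.indep_vars_iff_distr_eq_PiM'[OF p])
    have "distr M (\<Pi>\<^sub>M i\<in>{..<p}. borel) (\<lambda>x. \<lambda>i\<in>{..<p}. x i) = distr M M (\<lambda>x. x)"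
      by (intro distr_cong) (auto simp: M_def std_gaussian_vec_def space_PiM sets_normal_law PiE_iff extensional_restrict
          intro!: sets_PiM_cong)
    also have "\<dots> = M" by (simp add: distr_id)
    also have "\<dots> = (\<Pi>\<^sub>M i\<in>{..<p}. distr M borel (\<lambda>x. x i))"
      unfolding M_def std_gaussian_vec_def using comp
      by (intro PiM_cong) (auto simp: M_def std_gaussian_vec_def)
    finally show "distr M (\<Pi>\<^sub>M i\<in>{..<p}. borel) (\<lambda>x. \<lambda>i\<in>{..<p}. x i) = (\<Pi>\<^sub>M i\<in>{..<p}. distr M borel (\<lambda>x. x i))" .
  qed (auto intro: meas)
  then have "M.indep_vars (\<lambda>_. borel) (\<lambda>i x. w i * x i) {..<p}"
    by (rule M.indep_vars_compose2) auto
  then have ind: "M.indep_vars (\<lambda>_. borel) (\<lambda>i x. w i * x i) I"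
    using I(2) by (rule M.indep_vars_subset)
  have "distributed M lborel (\<lambda>x. \<Sum>i\<in>I. w i * x i)
      (normal_density (\<Sum>i\<in>I. 0) (sqrt (\<Sum>i\<in>I. \<bar>w i\<bar>\<^sup>2)))"
  proof (rule M.sum_indep_normal[OF I(1) \<open>I \<noteq> {}\<close> ind])
    fix i assume i: "i \<in> I"
    then show "0 < \<bar>w i\<bar>" by (simp add: I_def)
    have "distributed M lborel (\<lambda>x. x i) (\<lambda>x. ennreal (normal_density 0 1 x))"
      unfolding distributed_def using i meas[of i] comp[of i]
      by (auto simp: I_def normal_law_def cong: distr_cong)
    from M.normal_density_affine[OF this, of "w i" 0] i
    show "distributed M lborel (\<lambda>x. w i * x i) (normal_density 0 \<bar>w i\<bar>)" by (simp add: I_def)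
  qed
  then have "distr M lborel (\<lambda>x. \<Sum>i\<in>I. w i * x i) = normal_law 0 (vnorm p w)"
    by (simp add: distributed_def normal_law_def vn)
  moreover have "(\<lambda>x. \<Sum>i\<in>I. w i * x i) = dotp p w"
    unfolding dotp_def I_def fun_eq_iff by (intro allI sum.mono_neutral_cong_left) auto
  moreover have "distr M borel (dotp p w) = distr M lborel (dotp p w)"
    by (intro distr_cong) auto
  ultimately show ?thesis by (simp only: M_def)
qed

text \<open>Net points are only known to have norm at least \<open>1/2\<close>, so the bound on the
  density has to cover all these deviations; \<open>2 * pi / 4\<close> already exceeds 1.\<close>

lemma normal_density_le:
  assumes "1/2 \<le> s"
  shows "normal_density 0 s x \<le> 1"
proof -
  have "1 \<le> sqrt (2 * pi * s\<^sup>2)"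
  proof -
    have "2 * 3 * (1/2)\<^sup>2 \<le> 2 * pi * s\<^sup>2" using assms pi_gt3 by (intro mult_mono power_mono) auto
    then show ?thesis by (simp add: power2_eq_square)
  qed
  moreover have "exp (- (x - 0)\<^sup>2 / (2 * s\<^sup>2)) \<le> 1" by simp
  ultimately show ?thesis unfolding normal_density_def
    by (intro mult_le_one) (auto simp: divide_le_eq_1)
qed

lemma normal_law_ball_le:
  assumes s: "1/2 \<le> s" and a: "0 \<le> a"
  shows "measure (normal_law 0 s) {x. \<bar>x - c\<bar> \<le> a} \<le> 2 * a"
proof -
  interpret prob_space "normal_law 0 s" using s by (intro prob_space_normal_law) simp
  have S: "{x. \<bar>x - c\<bar> \<le> a} = {c - a..c + a}" by auto
  have "emeasure (normal_law 0 s) {c - a..c + a} = (\<integral>\<^sup>+x\<in>{c - a..c + a}. ennreal (normal_density 0 s x) \<partial>lborel)"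
    unfolding normal_law_def by (subst emeasure_density) auto
  also have "\<dots> \<le> (\<integral>\<^sup>+x\<in>{c - a..c + a}. ennreal 1 \<partial>lborel)"
    using normal_density_le[OF s] by (intro nn_integral_mono mult_right_mono ennreal_leI) auto
  also have "\<dots> = ennreal (2 * a)" using a by simp
  finally show ?thesis using a unfolding S by (simp add: emeasure_eq_measure)
qed

lemma normal_law_abs_le:
  assumes s: "0 < s"
  shows "integrable (normal_law 0 s) (\<lambda>x. \<bar>x\<bar>)" "(\<integral>x. \<bar>x\<bar> \<partial>normal_law 0 s) \<le> s"
proof -
  have i: "integrable lborel (\<lambda>x. normal_density 0 s x * \<bar>x - 0\<bar> ^ 1)"
    by (rule integrable_normal_moment_abs[OF s])
  have "(\<integral>x. normal_density 0 s x * \<bar>x - 0\<bar> ^ (2 * 0 + 1) \<partial>lborel) = 2 ^ 0 * s ^ (2 * 0 + 1) * fact 0 * sqrt (2 / pi)"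
    by (rule integral_normal_moment_abs_odd[OF s])
  moreover have "sqrt (2 / pi) \<le> 1" using pi_gt3 by simp
  ultimately show "(\<integral>x. \<bar>x\<bar> \<partial>normal_law 0 s) \<le> s"
    using s unfolding normal_law_def by (subst integral_density) (auto simp: mult_le_cancel_left1)
  show "integrable (normal_law 0 s) (\<lambda>x. \<bar>x\<bar>)"
    using i unfolding normal_law_def by (subst integrable_density) auto
qed

lemma normal_law_exp:
  assumes s: "0 < s"
  shows "(\<integral>\<^sup>+x. ennreal (exp (c * x)) \<partial>normal_law 0 s) = ennreal (exp (c\<^sup>2 * s\<^sup>2 / 2))"
proof -
  have "(\<integral>\<^sup>+x. ennreal (exp (c * x)) \<partial>normal_law 0 s)
      = (\<integral>\<^sup>+x. ennreal (normal_density 0 s x * exp (c * x)) \<partial>lborel)"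
    unfolding normal_law_def by (subst nn_integral_density) (auto simp: ennreal_mult)
  also have "\<dots> = (\<integral>\<^sup>+x. ennreal (exp (c\<^sup>2 * s\<^sup>2 / 2)) * ennreal (normal_density (c * s\<^sup>2) s x) \<partial>lborel)"
  proof (intro nn_integral_cong)
    fix x
    \<comment> \<open>Completing the square: tilting by \<open>exp (c * x)\<close> moves the mean to
      \<open>c * s\<^sup>2\<close> and keeps the deviation.\<close>
    have "- x\<^sup>2 / (2 * s\<^sup>2) + c * x = c\<^sup>2 * s\<^sup>2 / 2 + - (x - c * s\<^sup>2)\<^sup>2 / (2 * s\<^sup>2)"
      using s by (simp add: field_simps power2_eq_square)
    then have "exp (- x\<^sup>2 / (2 * s\<^sup>2)) * exp (c * x) = exp (c\<^sup>2 * s\<^sup>2 / 2) * exp (- (x - c * s\<^sup>2)\<^sup>2 / (2 * s\<^sup>2))"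
      by (simp only: exp_add[symmetric])
    then show "ennreal (normal_density 0 s x * exp (c * x)) = ennreal (exp (c\<^sup>2 * s\<^sup>2 / 2)) * ennreal (normal_density (c * s\<^sup>2) s x)"
      unfolding normal_density_def by (simp add: mult_ac flip: ennreal_mult)
  qed
  also have "\<dots> = ennreal (exp (c\<^sup>2 * s\<^sup>2 / 2)) * emeasure (normal_law (c * s\<^sup>2) s) UNIV"
    unfolding normal_law_def by (subst emeasure_density, simp, simp, subst nn_integral_cmult) auto
  also have "emeasure (normal_law (c * s\<^sup>2) s) UNIV = 1"
    using prob_space.emeasure_space_1[OF prob_space_normal_law[OF s, of "c * s\<^sup>2"]] by simp
  finally show ?thesis by simp
qed

lemma normal_law_exp_abs_le:
  assumes s: "0 < s"
  shows "(\<integral>\<^sup>+x. ennreal (exp \<bar>x\<bar>) \<partial>normal_law 0 s) \<le> ennreal (2 * exp (s\<^sup>2 / 2))"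
proof -
  have "(\<integral>\<^sup>+x. ennreal (exp \<bar>x\<bar>) \<partial>normal_law 0 s)
     \<le> (\<integral>\<^sup>+x. ennreal (exp (1 * x)) + ennreal (exp (- 1 * x)) \<partial>normal_law 0 s)"
    by (intro nn_integral_mono) (auto simp: abs_if simp flip: ennreal_plus intro!: ennreal_leI)
  also have "\<dots> = ennreal (exp (1\<^sup>2 * s\<^sup>2 / 2)) + ennreal (exp ((- 1)\<^sup>2 * s\<^sup>2 / 2))"
    using sets_normal_law[of 0 s] by (subst nn_integral_add) (auto simp only: normal_law_exp[OF s], measurable)
  also have "\<dots> = ennreal (2 * exp (s\<^sup>2 / 2))" by (simp flip: ennreal_plus)
  finally show ?thesis .
qed

section \<open>The tail function of the standard normal law\<close>

definition gauss_tail :: "real \<Rightarrow> real" where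
  "gauss_tail t = measure (normal_law 0 1) {t..}"

lemma std_normal_uminus: "distr (normal_law 0 1) borel uminus = normal_law 0 1"
proof -
  interpret prob_space "normal_law 0 1" by (rule prob_space_normal_law) simp
  from normal_density_affine[OF std_normal_distributed_id, of "-1" 0]
  show ?thesis unfolding distributed_def normal_law_def
    by (simp add: distr_cong[OF refl sets_lborel])
qed

lemma gauss_tail_lower: "measure (normal_law 0 1) {..- t} = gauss_tail t"
proof -
  have "measure (normal_law 0 1) {..- t} = measure (distr (normal_law 0 1) borel uminus) {..- t}"
    by (simp add: std_normal_uminus)
  also have "\<dots> = measure (normal_law 0 1) {t..}"
    by (subst measure_distr) (auto simp: sets_normal_law intro!: arg_cong[where f = "measure _"])
  finally show ?thesis by (simp add: gauss_tail_def)
qed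

lemma normal_law_upper:
  assumes "0 < s"
  shows "measure (normal_law m s) {y. a \<le> y - m} = gauss_tail (a / s)"
    and "measure (normal_law m s) {y. y - m \<le> - a} = gauss_tail (a / s)"
proof -
  show "measure (normal_law m s) {y. a \<le> y - m} = gauss_tail (a / s)"
    unfolding gauss_tail_def normal_law_affine[OF assms, of m] using assms
    by (subst measure_distr) (auto simp: sets_normal_law field_simps intro!: arg_cong[where f = "measure _"])
  have "s * x \<le> - a \<longleftrightarrow> x \<le> - (a / s)" for x
    using assms by (auto simp: field_simps)
  then show "measure (normal_law m s) {y. y - m \<le> - a} = gauss_tail (a / s)"
    unfolding gauss_tail_lower[symmetric] normal_law_affine[OF assms, of m]
    by (subst measure_distr) (auto simp: sets_normal_law intro!: arg_cong[where f = "measure _"])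
qed

lemma gauss_tail_two_sided:
  assumes "0 < t"
  shows "measure (normal_law 0 1) {x. t \<le> \<bar>x\<bar>} = 2 * gauss_tail t"
proof -
  interpret prob_space "normal_law 0 1" by (rule prob_space_normal_law) simp
  have "{x. t \<le> \<bar>x\<bar>} = {t..} \<union> {..- t}" by auto
  then have "measure (normal_law 0 1) {x. t \<le> \<bar>x\<bar>} = gauss_tail t + measure (normal_law 0 1) {..- t}"
    using assms unfolding gauss_tail_def by (subst finite_measure_Union[symmetric]) (auto simp: sets_normal_law)
  then show ?thesis by (simp add: gauss_tail_lower)
qed

text \<open>Strict inequalities are required because the sign of a zero residual is 0. They cost
  nothing, as the law has no atom at \<open>m\<close>.\<close>

lemma normal_law_half:
  assumes "0 < s"
  shows "measure (normal_law m s) {y. 0 < y - m} = 1/2" "measure (normal_law m s) {y. y - m < 0} = 1/2"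
proof -
  interpret prob_space "normal_law m s" by (rule prob_space_normal_law) fact
  have z: "measure (normal_law m s) {m} = 0"
    unfolding normal_law_def measure_def by (simp add: emeasure_density nn_integral_null_set null_sets_def)
  define a where "a = measure (normal_law m s) {y. 0 < y - m}"
  define b where "b = measure (normal_law m s) {y. y - m < 0}"
  have "measure (normal_law m s) {y. 0 \<le> y - m} = measure (normal_law m s) ({y. 0 < y - m} \<union> {m})"
    by (intro arg_cong[where f = "measure _"]) auto
  also have "\<dots> = a" unfolding a_def by (subst finite_measure_Union) (auto simp: sets_normal_law z)
  finally have 1: "gauss_tail 0 = a" using normal_law_upper(1)[OF assms, of m 0] by simp
  have "measure (normal_law m s) {y. y - m \<le> - 0} = measure (normal_law m s) ({y. y - m < 0} \<union> {m})"
    by (intro arg_cong[where f = "measure _"]) auto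
  also have "\<dots> = b" unfolding b_def by (subst finite_measure_Union) (auto simp: sets_normal_law z)
  finally have 2: "gauss_tail 0 = b" using normal_law_upper(2)[OF assms, of m 0] by simp
  have "1 = measure (normal_law m s) ({y. 0 \<le> y - m} \<union> {y. y - m < 0})"
  proof -
    have "{y. 0 \<le> y - m} \<union> {y. y - m < 0} = space (normal_law m s)" by auto
    then show ?thesis using prob_space by metis
  qed
  also have "\<dots> = gauss_tail 0 + b" unfolding b_def
    using normal_law_upper(1)[OF assms, of m 0] by (subst finite_measure_Union) (auto simp: sets_normal_law)
  finally show "measure (normal_law m s) {y. 0 < y - m} = 1/2" "measure (normal_law m s) {y. y - m < 0} = 1/2"
    using 1 2 by (simp_all add: a_def b_def)
qed

lemma measure_std_normal_interval_ge:
  assumes "a \<le> b" "\<And>x. a \<le> x \<Longrightarrow> x \<le> b \<Longrightarrow> d \<le> normal_density 0 1 x" "0 \<le> d"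
  shows "d * (b - a) \<le> measure (normal_law 0 1) {a<..<b}"
proof -
  interpret prob_space "normal_law 0 1" by (rule prob_space_normal_law) simp
  have "ennreal (d * (b - a)) = (\<integral>\<^sup>+x\<in>{a<..<b}. ennreal d \<partial>lborel)"
    using assms by (simp add: nn_integral_cmult ennreal_mult)
  also have "\<dots> \<le> (\<integral>\<^sup>+x\<in>{a<..<b}. ennreal (normal_density 0 1 x) \<partial>lborel)"
    using assms by (intro nn_integral_mono) (auto simp: indicator_def intro: ennreal_leI)
  also have "\<dots> = emeasure (normal_law 0 1) {a<..<b}"
    unfolding normal_law_def by (subst emeasure_density) auto
  finally show ?thesis by (simp add: emeasure_eq_measure)
qed

lemma sqrt_2pi_le: "sqrt (2 * pi) \<le> 2.6"
proof -
  have "2 * pi \<le> 2.6\<^sup>2" using pi_less_4 pi_approx by (simp add: power2_eq_square)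
  then show ?thesis by (intro real_le_lsqrt) auto
qed

text \<open>On the interval from \<open>t\<close> to \<open>t + 1\<close> the density is at least a
  multiple of \<open>exp (- t\<^sup>2)\<close>, since
  \<open>(t + 1)\<^sup>2 \<le> 2 * t\<^sup>2 + 2\<close>. The exponent is cruder than the sharp
  \<open>t\<^sup>2 / 2\<close>, but it is the one that matches the factor
  \<open>exp (t\<^sup>2)\<close> in the rate.\<close>

lemma gauss_tail_ge:
  assumes "0 \<le> t"
  shows "exp (- t\<^sup>2) / 10 \<le> gauss_tail t"
proof -
  interpret prob_space "normal_law 0 1" by (rule prob_space_normal_law) simp
  have 1: "exp (- t\<^sup>2) / 10 \<le> normal_density 0 1 x" if "t \<le> x" "x \<le> t + 1" for x
  proof -
    have "x\<^sup>2 \<le> (t + 1)\<^sup>2" using that assms by (intro power_mono) auto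
    also have "\<dots> \<le> 2 * t\<^sup>2 + 2"
      using zero_le_power2[of "t - 1"] by (simp add: power2_eq_square algebra_simps)
    finally have "exp (- t\<^sup>2 - 1) \<le> exp (- x\<^sup>2 / 2)" by simp
    then have "exp (- t\<^sup>2) / exp 1 \<le> exp (- x\<^sup>2 / 2)" by (simp add: exp_diff)
    moreover have "exp (- t\<^sup>2) / 3 \<le> exp (- t\<^sup>2) / exp 1"
      using exp_le by (intro divide_left_mono) auto
    ultimately have "exp (- t\<^sup>2) / 3 \<le> exp (- x\<^sup>2 / 2)" by (rule order.trans[rotated])
    then have "exp (- t\<^sup>2) / 3 / 2.6 \<le> exp (- x\<^sup>2 / 2) / sqrt (2 * pi)"
      using sqrt_2pi_le by (intro frac_le) auto
    moreover have "exp (- t\<^sup>2) / 10 \<le> exp (- t\<^sup>2) / 3 / 2.6" by simp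
    moreover have "normal_density 0 1 x = exp (- x\<^sup>2 / 2) / sqrt (2 * pi)"
      by (simp add: std_normal_density_def)
    ultimately show ?thesis by linarith
  qed
  have "exp (- t\<^sup>2) / 10 * ((t + 1) - t) \<le> measure (normal_law 0 1) {t<..<t+1}"
    by (intro measure_std_normal_interval_ge 1) auto
  also have "\<dots> \<le> gauss_tail t"
    unfolding gauss_tail_def by (intro finite_measure_mono) (auto simp: sets_normal_law)
  finally show ?thesis by simp
qed

text \<open>The density is at least \<open>1/5\<close> between -1 and 1, so the central mass grows
  linearly until \<open>y = 1\<close>. With \<open>y = e * t / \<sigma>\<close> this is the depth,
  relative to \<open>gauss_tail t\<close>, that a point at distance \<open>e\<close> from
  \<open>\<beta>\<close> loses.\<close>

lemma gauss_central_mass_ge: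
  assumes "0 < y"
  shows "2/5 * min y 1 \<le> 1 - 2 * gauss_tail y"
proof -
  interpret prob_space "normal_law 0 1" by (rule prob_space_normal_law) simp
  define m where "m = min y 1"
  have m: "0 < m" "m \<le> 1" "m \<le> y" using assms by (auto simp: m_def)
  have 1: "1/5 \<le> normal_density 0 1 x" if x: "- m \<le> x" "x \<le> m" for x
  proof -
    have "\<bar>x\<bar> \<le> 1" using x m by auto
    then have "x\<^sup>2 \<le> 1" by (simp add: abs_square_le_1)
    have "exp (1/2::real) \<le> 1 + 1/2 + (1/2)\<^sup>2" by (rule exp_bound) auto
    then have "13/25 \<le> exp (-1/2::real)" by (simp add: exp_minus field_simps power2_eq_square)
    also have "\<dots> \<le> exp (- x\<^sup>2 / 2)" using \<open>x\<^sup>2 \<le> 1\<close> by simp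
    finally have "(13/25) / 2.6 \<le> exp (- x\<^sup>2 / 2) / sqrt (2 * pi)"
      using sqrt_2pi_le by (intro frac_le) auto
    then show ?thesis by (simp add: std_normal_density_def)
  qed
  have "1/5 * (m - (- m)) \<le> measure (normal_law 0 1) {-m<..<m}"
    using m by (intro measure_std_normal_interval_ge 1) auto
  moreover have "measure (normal_law 0 1) {-m<..<m} + 2 * gauss_tail y = measure (normal_law 0 1) ({-m<..<m} \<union> {x. y \<le> \<bar>x\<bar>})"
    using m unfolding gauss_tail_two_sided[OF assms, symmetric]
    by (subst finite_measure_Union) (auto simp: sets_normal_law)
  moreover note prob_le_1[of "{-m<..<m} \<union> {x. y \<le> \<bar>x\<bar>}"]
  ultimately have "2/5 * m \<le> 1 - 2 * gauss_tail y" by argo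
  then show ?thesis by (simp only: m_def)
qed

section \<open>Uniform deviations over half spaces\<close>

definition vscale :: "nat \<Rightarrow> real \<Rightarrow> vec \<Rightarrow> vec" where
  "vscale p c v = (\<lambda>i\<in>{..<p}. c * v i)"

lemma dotp_vscale: "dotp p (vscale p c v) x = c * dotp p v x"
  by (simp add: dotp_def vscale_def sum_distrib_left mult.assoc)

lemma abs_dotp_le: "\<bar>dotp p u v\<bar> \<le> vnorm p u * vnorm p v"
proof -
  have "\<bar>dotp p u v\<bar> \<le> (\<Sum>i<p. \<bar>u i\<bar> * \<bar>v i\<bar>)"
    unfolding dotp_def by (intro order.trans[OF sum_abs]) (simp add: abs_mult)
  also have "\<dots> \<le> vnorm p u * vnorm p v" unfolding vnorm_def by (rule L2_set_mult_ineq)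
  finally show ?thesis .
qed

lemma vscale_in_unit_sphere:
  assumes "0 < vnorm p v"
  shows "vscale p (1 / vnorm p v) v \<in> unit_sphere p"
proof -
  have "L2_set (vscale p (1 / vnorm p v) v) {..<p} = L2_set (\<lambda>i. 1 / vnorm p v * v i) {..<p}"
    by (intro L2_set_cong) (auto simp: vscale_def)
  also have "\<dots> = 1 / vnorm p v * vnorm p v"
    using assms unfolding vnorm_def by (subst L2_set_right_distrib[symmetric]) auto
  finally show ?thesis using assms by (auto simp: unit_sphere_def Rvec_def vscale_def)
qed

lemma vnorm_unit_sphere: "v \<in> unit_sphere p \<Longrightarrow> vnorm p v = 1"
  by (simp add: unit_sphere_def vnorm_def)

lemma unit_sphere_nonempty: "1 \<le> p \<Longrightarrow> unit_sphere p \<noteq> {}"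
proof -
  assume "1 \<le> p"
  define v where "v = (\<lambda>i\<in>{..<p}. of_bool (i = 0) :: real)"
  have "(\<Sum>i<p. (v i)\<^sup>2) = (\<Sum>i\<in>{0::nat}. 1)"
    using \<open>1 \<le> p\<close> unfolding v_def by (intro sum.mono_neutral_cong_right) auto
  then have "v \<in> unit_sphere p" by (simp add: unit_sphere_def Rvec_def v_def L2_set_def)
  then show ?thesis by blast
qed

text \<open>Approximating a unit vector by the net costs at most \<open>1/16\<close> of the supremum itself, which can
  therefore be absorbed.\<close>

lemma sum_abs_dotp_le_net:
  assumes p: "1 \<le> p" and net: "\<And>w. w \<in> sphere_net p 1 \<Longrightarrow> (\<Sum>i<n. \<bar>dotp p w (x i)\<bar>) \<le> s"
  shows "(\<Sum>i<n. \<bar>dotp p z (x i)\<bar>) \<le> 2 * s * vnorm p z"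
proof -
  define A where "A = (\<lambda>z. \<Sum>i<n. \<bar>dotp p z (x i)\<bar>)"
  have A_bd: "A v \<le> vnorm p v * (\<Sum>i<n. vnorm p (x i))" for v
    unfolding A_def sum_distrib_left by (intro sum_mono abs_dotp_le)
  have A_nn: "0 \<le> A v" for v by (simp add: A_def sum_nonneg)
  define T where "T = (SUP v\<in>unit_sphere p. A v)"
  \<comment> \<open>Absorbing \<open>T / 16\<close> needs a genuine supremum. A crude bound that
    depends on the sample is enough for this.\<close>
  have bdd: "bdd_above (A ` unit_sphere p)"
    using A_bd by (intro bdd_aboveI2[where M = "\<Sum>i<n. vnorm p (x i)"]) (metis mult_1 vnorm_unit_sphere)
  have AT: "A z \<le> T * vnorm p z" for z
  proof (cases "vnorm p z = 0")
    case True
    then show ?thesis using A_bd[of z] by simp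
  next
    case False
    then have z: "0 < vnorm p z" by (simp add: order_less_le)
    have "A (vscale p (1 / vnorm p z) z) \<le> T"
      unfolding T_def by (intro cSUP_upper bdd vscale_in_unit_sphere z)
    moreover have "A (vscale p (1 / vnorm p z) z) = A z / vnorm p z"
      unfolding A_def dotp_vscale using z by (simp add: abs_mult sum_divide_distrib)
    ultimately show ?thesis using z by (simp add: divide_le_eq)
  qed
  have "T \<le> s + T / 16"
    unfolding T_def
  proof (rule cSUP_least[OF unit_sphere_nonempty[OF p]])
    fix v assume v: "v \<in> unit_sphere p"
    define w where "w = grid_round p 1 v"
    have T0: "0 \<le> T" using A_nn[of v] AT[of v] v by (simp add: vnorm_unit_sphere)
    have "A v \<le> A w + A (vsub p v w)"
      unfolding A_def dotp_vsub sum.distrib[symmetric] by (intro sum_mono) auto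
    also have "A w \<le> s" unfolding A_def w_def by (rule net) (simp add: sphere_net_def v)
    also have "A (vsub p v w) \<le> T * vnorm p (vsub p v w)" by (rule AT)
    also have "\<dots> \<le> T * (1 / 16)"
      using vnorm_grid_round_le[of p v 1] T0 by (intro mult_left_mono) (auto simp: w_def)
    finally show "A v \<le> s + (SUP v\<in>unit_sphere p. A v) / 16" by (simp add: T_def)
  qed
  then have "T \<le> 2 * s"
  proof -
    obtain v where v: "v \<in> unit_sphere p" using unit_sphere_nonempty[OF p] by blast
    have "0 \<le> T" using A_nn[of v] AT[of v] v by (simp add: vnorm_unit_sphere)
    with \<open>T \<le> s + T / 16\<close> show ?thesis by linarith
  qed
  then have "T * vnorm p z \<le> 2 * s * vnorm p z" by (intro mult_right_mono) auto
  with AT[of z] show ?thesis by (simp add: A_def)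
qed

definition emp_mean :: "nat \<Rightarrow> (nat \<Rightarrow> 'a) \<Rightarrow> ('a \<Rightarrow> real) \<Rightarrow> real" where
  "emp_mean n S f = (\<Sum>i<n. f (S i)) / real n"

lemma emp_mean_diff: "emp_mean n S (\<lambda>x. f x - g x) = emp_mean n S f - emp_mean n S g"
  by (simp add: emp_mean_def sum_subtractf diff_divide_distrib)

lemma emp_mean_add: "emp_mean n S (\<lambda>x. f x + g x) = emp_mean n S f + emp_mean n S g"
  by (simp add: emp_mean_def sum.distrib add_divide_distrib)

lemma emp_mean_mono: "(\<And>i. i < n \<Longrightarrow> f (S i) \<le> g (S i)) \<Longrightarrow> emp_mean n S f \<le> emp_mean n S g"
  unfolding emp_mean_def by (intro divide_right_mono sum_mono) auto

lemma emp_mean_abs: "\<bar>emp_mean n S f\<bar> \<le> emp_mean n S (\<lambda>x. \<bar>f x\<bar>)"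
  unfolding emp_mean_def by (simp add: divide_right_mono)

text \<open>A union bound. Measurability of the exceptional event is a separate conclusion because
  the final guarantee, an inner probability, has to exhibit a measurable set.\<close>

lemma iid_bernstein_family:
  fixes F :: "('a \<Rightarrow> real) set" and n :: nat
  assumes \<mu>: "prob_space \<mu>" and fin: "finite F" and n: "0 < n" and \<tau>: "0 < \<tau>"
    and F: "\<And>f. f \<in> F \<Longrightarrow> f \<in> borel_measurable \<mu>" "\<And>f x. f \<in> F \<Longrightarrow> \<bar>f x\<bar> \<le> 1"
      "\<And>f. f \<in> F \<Longrightarrow> (\<integral>x. (f x)\<^sup>2 \<partial>\<mu>) \<le> q"
  defines "M \<equiv> \<Pi>\<^sub>M i\<in>{..<n}. \<mu>"
  defines "A \<equiv> {S \<in> space M. \<exists>f\<in>F. (\<integral>x. f x \<partial>\<mu>) + (2 * sqrt (q * \<tau> / real n) + 2 * \<tau> / real n) \<le> emp_mean n S f}"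
  shows "A \<in> sets M" and "measure M A \<le> real (card F) * exp (- \<tau>)"
proof -
  interpret M: prob_space M unfolding M_def by (intro prob_space_PiM \<mu>)
  define E where "E = (\<lambda>f. {S \<in> space M. real n * (\<integral>x. f x \<partial>\<mu>) + (2 * sqrt (real n * q * \<tau>) + 2 * \<tau>) \<le> (\<Sum>i<n. f (S i))})"
  have "real n * sqrt (q * \<tau> / real n) = sqrt (real n * q * \<tau>)"
  proof -
    have "real n * sqrt (q * \<tau> / real n) = sqrt ((real n)\<^sup>2 * (q * \<tau> / real n))"
      unfolding real_sqrt_mult[of "(real n)\<^sup>2"] by simp
    also have "(real n)\<^sup>2 * (q * \<tau> / real n) = real n * q * \<tau>" using n by (simp add: power2_eq_square)
    finally show ?thesis .
  qed
  moreover have "a + (2 * s + 2 * \<tau> / real n) \<le> b / real n \<longleftrightarrow> real n * a + (2 * (real n * s) + 2 * \<tau>) \<le> b" for a b s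
    using n by (simp add: pos_le_divide_eq algebra_simps)
  ultimately have "a + (2 * sqrt (q * \<tau> / real n) + 2 * \<tau> / real n) \<le> b / real n
      \<longleftrightarrow> real n * a + (2 * sqrt (real n * q * \<tau>) + 2 * \<tau>) \<le> b" for a b
    by simp
  then have A: "A = (\<Union>f\<in>F. E f)"
    unfolding A_def E_def emp_mean_def by auto
  have Em: "E f \<in> sets M" if "f \<in> F" for f
  proof -
    note F(1)[OF that, measurable]
    show ?thesis unfolding E_def M_def by measurable
  qed
  then show "A \<in> sets M" unfolding A using fin by (intro sets.finite_UN) auto
  have "measure M A \<le> (\<Sum>f\<in>F. measure M (E f))"
    unfolding A using fin Em by (intro M.finite_measure_subadditive_finite) auto
  also have "\<dots> \<le> (\<Sum>f\<in>F. exp (- \<tau>))"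
    unfolding E_def M_def by (intro sum_mono iid_bernstein \<mu> F \<tau> n)
  finally show "measure M A \<le> real (card F) * exp (- \<tau>)" by simp
qed

text \<open>Only the marginal law of the covariate is fixed; the sign may depend on it, and on
  further randomness, in any way. This freedom is what accommodates an adaptive contamination, and
  the same estimates apply to every truncation level of the sign.\<close>

locale signed_gaussian_design = prob_space \<mu> for \<mu> :: "'a measure" +
  fixes p :: nat and X :: "'a \<Rightarrow> vec" and \<rho> :: "'a \<Rightarrow> real" and t :: real
  assumes p: "1 \<le> p" and t: "0 < t"
    and X [measurable]: "X \<in> \<mu> \<rightarrow>\<^sub>M borel_vec p"
    and X_law: "distr \<mu> (borel_vec p) X = std_gaussian_vec p"
    and \<rho> [measurable]: "\<rho> \<in> borel_measurable \<mu>"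
    and \<rho>_sign: "\<rho> \<omega> \<in> {-1, 0, 1}"
begin

definition proj :: "vec \<Rightarrow> 'a \<Rightarrow> real" where
  "proj w \<omega> = dotp p w (X \<omega>)"

definition halfspace :: "vec \<Rightarrow> 'a \<Rightarrow> real" where
  "halfspace w \<omega> = of_bool (t \<le> \<rho> \<omega> * proj w \<omega>)"

text \<open>Both boundaries \<open>t\<close> and \<open>- t\<close> are covered, which removes the
  sign \<open>\<rho>\<close>: the mass depends on the Gaussian law of the projection alone.\<close>

definition band :: "real \<Rightarrow> vec \<Rightarrow> 'a \<Rightarrow> real" where
  "band a w \<omega> = of_bool (\<bar>proj w \<omega> - t\<bar> \<le> a \<or> \<bar>proj w \<omega> - (- t)\<bar> \<le> a)"

lemma proj_measurable [measurable]: "proj w \<in> borel_measurable \<mu>"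
  unfolding proj_def by measurable

lemma halfspace_measurable [measurable]: "halfspace w \<in> borel_measurable \<mu>"
  unfolding halfspace_def by measurable

lemma band_measurable [measurable]: "band a w \<in> borel_measurable \<mu>"
  unfolding band_def by measurable

lemma proj_law:
  assumes "0 < vnorm p w"
  shows "distr \<mu> borel (proj w) = normal_law 0 (vnorm p w)"
proof -
  have "distr \<mu> borel (proj w) = distr (distr \<mu> (borel_vec p) X) borel (dotp p w)"
    by (subst distr_distr) (auto simp: comp_def proj_def[abs_def])
  then show ?thesis using dotp_std_gaussian[OF assms] by (simp add: X_law)
qed

lemma proj_zero: "vnorm p w = 0 \<Longrightarrow> proj w \<omega> = 0"
  using abs_dotp_le[of p w "X \<omega>"] by (simp add: proj_def)

lemma integral_abs_proj: "integrable \<mu> (\<lambda>\<omega>. \<bar>proj w \<omega>\<bar>)" "(\<integral>\<omega>. \<bar>proj w \<omega>\<bar> \<partial>\<mu>) \<le> vnorm p w"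
proof -
  have "integrable \<mu> (\<lambda>\<omega>. \<bar>proj w \<omega>\<bar>) \<and> (\<integral>\<omega>. \<bar>proj w \<omega>\<bar> \<partial>\<mu>) \<le> vnorm p w"
  proof (cases "vnorm p w = 0")
    case True
    then show ?thesis by (simp add: proj_zero)
  next
    case False
    then have w: "0 < vnorm p w" by (simp add: order_less_le)
    have "integrable (distr \<mu> borel (proj w)) (\<lambda>x. \<bar>x\<bar>)" "(\<integral>x. \<bar>x\<bar> \<partial>distr \<mu> borel (proj w)) \<le> vnorm p w"
      using normal_law_abs_le[OF w] by (simp_all add: proj_law[OF w])
    then show ?thesis by (simp_all add: integrable_distr_eq integral_distr)
  qed
  then show "integrable \<mu> (\<lambda>\<omega>. \<bar>proj w \<omega>\<bar>)" "(\<integral>\<omega>. \<bar>proj w \<omega>\<bar> \<partial>\<mu>) \<le> vnorm p w" by auto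
qed

lemma nn_integral_exp_abs_proj:
  assumes "vnorm p w \<le> 2"
  shows "(\<integral>\<^sup>+\<omega>. ennreal (exp \<bar>proj w \<omega>\<bar>) \<partial>\<mu>) \<le> ennreal (exp 3)"
proof (cases "vnorm p w = 0")
  case True
  then show ?thesis by (simp add: proj_zero emeasure_space_1)
next
  case False
  then have w: "0 < vnorm p w" by (simp add: order_less_le)
  have "(\<integral>\<^sup>+\<omega>. ennreal (exp \<bar>proj w \<omega>\<bar>) \<partial>\<mu>) = (\<integral>\<^sup>+x. ennreal (exp \<bar>x\<bar>) \<partial>normal_law 0 (vnorm p w))"
    unfolding proj_law[OF w, symmetric] by (subst nn_integral_distr) auto
  also have "\<dots> \<le> ennreal (2 * exp ((vnorm p w)\<^sup>2 / 2))" by (rule normal_law_exp_abs_le[OF w])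
  also have "2 * exp ((vnorm p w)\<^sup>2 / 2) \<le> exp 1 * exp 2"
  proof (intro mult_mono)
    show "2 \<le> exp (1::real)" using exp_ge_add_one_self[of 1] by simp
    have "(vnorm p w)\<^sup>2 \<le> 2\<^sup>2" using assms by (intro power_mono) auto
    then show "exp ((vnorm p w)\<^sup>2 / 2) \<le> exp 2" by simp
  qed auto
  also have "exp 1 * exp 2 = (exp 3 :: real)" by (simp flip: exp_add)
  finally show ?thesis by (simp add: ennreal_leI)
qed

lemma expectation_band:
  assumes "1/2 \<le> vnorm p w" "0 \<le> a"
  shows "integrable \<mu> (band a w)" "(\<integral>\<omega>. band a w \<omega> \<partial>\<mu>) \<le> 4 * a"
proof -
  have w: "0 < vnorm p w" using assms by linarith
  show "integrable \<mu> (band a w)"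
    by (rule integrable_const_bound[where B = 1]) (auto simp: band_def)
  have one: "prob {\<omega> \<in> space \<mu>. \<bar>proj w \<omega> - c\<bar> \<le> a} \<le> 2 * a" for c
  proof -
    have "measure (distr \<mu> borel (proj w)) {x. \<bar>x - c\<bar> \<le> a} \<le> 2 * a"
      unfolding proj_law[OF w] by (rule normal_law_ball_le[OF assms])
    then show ?thesis by (subst (asm) measure_distr) (auto simp: vimage_def Int_def conj_commute)
  qed
  have "(\<integral>\<omega>. band a w \<omega> \<partial>\<mu>)
     = (\<integral>\<omega>. indicator ({\<omega> \<in> space \<mu>. \<bar>proj w \<omega> - t\<bar> \<le> a} \<union> {\<omega> \<in> space \<mu>. \<bar>proj w \<omega> - (- t)\<bar> \<le> a}) \<omega> \<partial>\<mu>)"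
    by (intro Bochner_Integration.integral_cong) (auto simp: band_def indicator_def)
  also have "\<dots> = prob ({\<omega> \<in> space \<mu>. \<bar>proj w \<omega> - t\<bar> \<le> a} \<union> {\<omega> \<in> space \<mu>. \<bar>proj w \<omega> - (- t)\<bar> \<le> a})"
    by (subst Bochner_Integration.integral_indicator) (auto intro!: arg_cong[where f = prob])
  also have "\<dots> \<le> prob {\<omega> \<in> space \<mu>. \<bar>proj w \<omega> - t\<bar> \<le> a} + prob {\<omega> \<in> space \<mu>. \<bar>proj w \<omega> - (- t)\<bar> \<le> a}"
    by (intro measure_Un_le) auto
  also have "\<dots> \<le> 2 * a + 2 * a" by (intro add_mono one)
  finally show "(\<integral>\<omega>. band a w \<omega> \<partial>\<mu>) \<le> 4 * a" by simp
qed

text \<open>With sign 0 both indicators vanish. Otherwise a change means that \<open>t\<close> or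
  \<open>- t\<close> separates the two projections, so either the one of \<open>w\<close> is within
  \<open>a\<close> of it or the two differ by at least \<open>a\<close>; the second case is relaxed
  as in Markov's inequality. The bound is pointwise in order to serve both the expectation and the
  empirical mean.\<close>

lemma halfspace_diff_le:
  assumes "0 < a"
  shows "\<bar>halfspace u \<omega> - halfspace w \<omega>\<bar> \<le> band a w \<omega> + \<bar>proj (vsub p u w) \<omega>\<bar> / a"
proof -
  have d: "proj (vsub p u w) \<omega> = proj u \<omega> - proj w \<omega>" by (simp add: proj_def dotp_vsub)
  have "\<rho> \<omega> = -1 \<or> \<rho> \<omega> = 0 \<or> \<rho> \<omega> = 1" using \<rho>_sign[of \<omega>] by auto
  then have "halfspace u \<omega> = halfspace w \<omega> \<or> band a w \<omega> = 1 \<or> a \<le> \<bar>proj u \<omega> - proj w \<omega>\<bar>"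
    unfolding halfspace_def band_def of_bool_eq_iff of_bool_eq_1_iff using t by (elim disjE; simp; arith)
  then consider "halfspace u \<omega> = halfspace w \<omega>" | "band a w \<omega> = 1" | "a \<le> \<bar>proj u \<omega> - proj w \<omega>\<bar>"
    by blast
  moreover have "\<bar>halfspace u \<omega> - halfspace w \<omega>\<bar> \<le> 1" "0 \<le> band a w \<omega>" "0 \<le> \<bar>proj (vsub p u w) \<omega>\<bar> / a"
    using assms by (auto simp: halfspace_def band_def)
  moreover have "1 \<le> \<bar>proj (vsub p u w) \<omega>\<bar> / a" if "a \<le> \<bar>proj u \<omega> - proj w \<omega>\<bar>"
    using assms that by (simp add: d)
  ultimately show ?thesis by cases linarith+
qed

lemma integrable_halfspace: "integrable \<mu> (halfspace w)"
  by (rule integrable_const_bound[where B = 1]) (auto simp: halfspace_def)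

lemma expectation_halfspace_diff:
  assumes "1/2 \<le> vnorm p w" "0 < a"
  shows "(\<integral>\<omega>. \<bar>halfspace u \<omega> - halfspace w \<omega>\<bar> \<partial>\<mu>) \<le> 4 * a + vnorm p (vsub p u w) / a"
proof -
  have "(\<integral>\<omega>. \<bar>halfspace u \<omega> - halfspace w \<omega>\<bar> \<partial>\<mu>)
      \<le> (\<integral>\<omega>. band a w \<omega> + \<bar>proj (vsub p u w) \<omega>\<bar> / a \<partial>\<mu>)"
  proof (rule integral_mono)
    show "integrable \<mu> (\<lambda>\<omega>. \<bar>halfspace u \<omega> - halfspace w \<omega>\<bar>)"
      by (intro integrable_abs Bochner_Integration.integrable_diff integrable_halfspace)
    show "integrable \<mu> (\<lambda>\<omega>. band a w \<omega> + \<bar>proj (vsub p u w) \<omega>\<bar> / a)"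
      using assms by (intro Bochner_Integration.integrable_add integrable_divide expectation_band integral_abs_proj) auto
  qed (rule halfspace_diff_le[OF assms(2)])
  also have "\<dots> = (\<integral>\<omega>. band a w \<omega> \<partial>\<mu>) + (\<integral>\<omega>. \<bar>proj (vsub p u w) \<omega>\<bar> \<partial>\<mu>) / a"
    using assms expectation_band[of w a] integral_abs_proj(1)[of "vsub p u w"] by simp
  also have "\<dots> \<le> 4 * a + vnorm p (vsub p u w) / a"
    using assms by (intro add_mono expectation_band divide_right_mono integral_abs_proj) auto
  finally show ?thesis .
qed

end

section \<open>Chaining from the nets to the whole sphere\<close>

text \<open>Bernstein's deviation for second moment \<open>8 / 4 ^ k\<close> and
  \<open>\<tau> = (7 * k + B) * p\<close>. The slope 7 exceeds the slope 6 in the logarithm of the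
  number of close pairs, so the failure probabilities decay at least like
  \<open>exp (- k)\<close>.\<close>

definition chain_dev :: "nat \<Rightarrow> nat \<Rightarrow> real \<Rightarrow> nat \<Rightarrow> real" where
  "chain_dev n p B k = 2 * sqrt (8 / 4 ^ k * ((7 * real k + B) * real p) / real n)
     + 2 * ((7 * real k + B) * real p) / real n"

text \<open>The square-root terms carry \<open>1 / 2 ^ k\<close> and converge. The linear ones add
  up to a multiple of \<open>(K + 1)\<^sup>2 * p / n\<close>, and \<open>(K + 1)\<^sup>2 \<le> 16 *
  4 ^ (K - 1) \<le> 16 * sqrt (n / p)\<close> turns this back into
  \<open>sqrt (p / n)\<close>.\<close>

lemma sum_chain_dev_le:
  fixes n p K :: nat
  assumes p: "1 \<le> p" "p \<le> n" and B: "1 \<le> B" and K: "1 \<le> K" "16 ^ (K - 1) \<le> real n / real p"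
  shows "(\<Sum>k\<le>K. chain_dev n p B k) \<le> (308 + 44 * B) * sqrt (real p / real n)"
proof -
  let ?r = "sqrt (real p / real n)"
  have n: "0 < n" using p by simp
  have r: "0 < ?r" using p n by simp
  have 1: "chain_dev n p B k \<le> 6 * ?r * ((7 * real k + B) / 2 ^ k) + 2 * (real p / real n) * (7 * real k + B)" for k
  proof -
    have "sqrt (8 / 4 ^ k * ((7 * real k + B) * real p) / real n) = sqrt 8 / 2 ^ k * sqrt (7 * real k + B) * ?r"
    proof -
      have "sqrt (4 ^ k) = 2 ^ k" by (simp add: real_sqrt_power)
      then show ?thesis by (simp add: real_sqrt_mult real_sqrt_divide)
    qed
    also have "\<dots> \<le> 3 / 2 ^ k * (7 * real k + B) * ?r"
    proof (intro mult_right_mono mult_mono divide_right_mono)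
      show "sqrt 8 \<le> (3::real)" by (intro real_le_lsqrt) auto
      have "1 \<le> 7 * real k + B" using B by simp
      then have "7 * real k + B \<le> (7 * real k + B)\<^sup>2" by (simp add: power2_eq_square)
      then show "sqrt (7 * real k + B) \<le> 7 * real k + B" using B by (intro real_le_lsqrt) auto
    qed (use B in auto)
    finally show ?thesis unfolding chain_dev_def by (simp add: field_simps)
  qed
  have "(\<Sum>k\<le>K. chain_dev n p B k)
     \<le> 6 * ?r * (\<Sum>k\<le>K. (7 * real k + B) / 2 ^ k) + 2 * (real p / real n) * (\<Sum>k\<le>K. 7 * real k + B)"
    unfolding sum_distrib_left sum.distrib[symmetric] by (intro sum_mono 1)
  moreover have "(\<Sum>k\<le>K. (7 * real k + B) / 2 ^ k) \<le> 2 * B + 14"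
  proof -
    \<comment> \<open>The subtracted term is the exact tail of the series, which makes the identity
      inductive.\<close>
    have "(\<Sum>k\<le>K. (7 * real k + B) / 2 ^ k) = 2 * B + 14 - (7 * real K + 14 + B) / 2 ^ K"
      by (induction K) (auto simp: field_simps)
    then show ?thesis using B by simp
  qed
  moreover have S: "(\<Sum>k\<le>K. 7 * real k + B) \<le> (real K + 1)\<^sup>2 * (7 + B)"
  proof -
    have "(\<Sum>k\<le>K. 7 * real k + B) \<le> (\<Sum>k\<le>K. (real K + 1) * (7 + B))"
    proof (intro sum_mono)
      fix k assume "k \<in> {..K}"
      then have "7 * real k + B \<le> 7 * real K + B" by simp
      also have "\<dots> \<le> (real K + 1) * (7 + B)" using B by (simp add: algebra_simps)
      finally show "7 * real k + B \<le> (real K + 1) * (7 + B)" .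
    qed
    then show ?thesis by (simp add: power2_eq_square mult.assoc add.commute)
  qed
  moreover have "2 * (real p / real n) * (\<Sum>k\<le>K. 7 * real k + B) \<le> 2 * (7 + B) * (real p / real n * (real K + 1)\<^sup>2)"
  proof -
    have "2 * (real p / real n) * ((real K + 1)\<^sup>2 * (7 + B)) = 2 * (7 + B) * (real p / real n * (real K + 1)\<^sup>2)"
      by (simp only: mult_ac)
    then show ?thesis by (metis (no_types) S mult_left_mono divide_nonneg_nonneg mult_nonneg_nonneg of_nat_0_le_iff zero_le_numeral)
  qed
  moreover have R: "real p / real n * (real K + 1)\<^sup>2 \<le> 16 * ?r"
  proof -
    have "(4 ^ (K - 1))\<^sup>2 \<le> real n / real p" using K(2) by (simp add: power2_eq_square flip: power_mult_distrib)
    then have "4 ^ (K - 1) \<le> sqrt (real n / real p)" by (rule real_le_rsqrt)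
    moreover have "(real K + 1)\<^sup>2 \<le> 16 * 4 ^ (K - 1)"
    proof -
      have "real (K + 1) \<le> 2 ^ (K + 1)" by (rule of_nat_less_two_power[THEN less_imp_le])
      then have "(real K + 1)\<^sup>2 \<le> (2 ^ (K + 1))\<^sup>2" by (intro power_mono) auto
      also have "\<dots> = 4 ^ (K + 1)" by (simp add: power2_eq_square flip: power_mult_distrib)
      also have "\<dots> = 16 * 4 ^ (K - 1)" using K(1) by (cases K) auto
      finally show ?thesis .
    qed
    ultimately have "real p / real n * (real K + 1)\<^sup>2 \<le> real p / real n * (16 * sqrt (real n / real p))"
      by (intro mult_left_mono) auto
    also have "real p / real n = ?r * ?r" by simp
    also have "?r * ?r * (16 * sqrt (real n / real p)) = 16 * ?r * (?r * sqrt (real n / real p))"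
      by (simp only: ac_simps)
    also have "?r * sqrt (real n / real p) = 1" using p n by (simp flip: real_sqrt_mult)
    finally show ?thesis by simp
  qed
  ultimately have "(\<Sum>k\<le>K. chain_dev n p B k) \<le> 6 * ?r * (2 * B + 14) + 2 * (7 + B) * (16 * ?r)"
    using r B by (meson add_mono mult_left_mono order.trans less_imp_le mult_nonneg_nonneg add_nonneg_nonneg zero_le_numeral zero_le_one)
  then show ?thesis by (simp add: algebra_simps)
qed

text \<open>Both bounds matter: the lower one keeps the number of levels logarithmic in
  \<open>x\<close>, the upper one makes the last scale at most \<open>1 / x\<close>.\<close>

lemma ex_scale:
  fixes x :: real
  assumes "1 \<le> x"
  obtains K :: nat where "1 \<le> K" "16 ^ (K - 1) \<le> x" "x \<le> 16 ^ K"
proof -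
  define K where "K = (LEAST k. x < 16 ^ k)"
  obtain m where m: "x < 16 ^ m" using real_arch_pow[of 16 x] by auto
  have 1: "x < 16 ^ K" unfolding K_def by (rule LeastI[of "\<lambda>k. x < 16 ^ k", OF m])
  then have "K \<noteq> 0" using assms by (intro notI) simp
  then have "\<not> x < 16 ^ (K - 1)" unfolding K_def by (intro not_less_Least) (simp add: K_def[symmetric])
  then show ?thesis using 1 \<open>K \<noteq> 0\<close> by (intro that[of K]) auto
qed

context signed_gaussian_design
begin

text \<open>The tolerance \<open>2 / 16 ^ k\<close> admits the roundings of one common vector at two
  consecutive levels, whose distances to it are at most \<open>1 / 16 ^ k\<close> and
  \<open>1 / 16 ^ (k + 1)\<close>.\<close>

definition close_pairs :: "nat \<Rightarrow> (vec \<times> vec) set" where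
  "close_pairs k = {(u, w). u \<in> sphere_net p (Suc k) \<and> w \<in> sphere_net p k \<and> vnorm p (vsub p u w) \<le> 2 / 16 ^ k}"

text \<open>The chain starts at the net of level 1, since the lower bound
  \<open>1 - 1 / 16 ^ k\<close> on the norm of a rounded vector is void at level 0. Half spaces and
  increments occur with both signs because Bernstein's bound is one-sided; the bands of the last
  level are only bounded from above.\<close>

definition chain_family :: "nat \<Rightarrow> nat \<Rightarrow> ('a \<Rightarrow> real) set" where
  "chain_family K k =
     (if k = 0 then halfspace ` sphere_net p 1 \<union> (\<lambda>w \<omega>. - halfspace w \<omega>) ` sphere_net p 1
      else if k < K then (\<lambda>(u, w) \<omega>. halfspace u \<omega> - halfspace w \<omega>) ` close_pairs k
        \<union> (\<lambda>(u, w) \<omega>. halfspace w \<omega> - halfspace u \<omega>) ` close_pairs k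
      else band (1 / 4 ^ k) ` sphere_net p k)"

lemma sphere_net_norm:
  assumes "w \<in> sphere_net p k" "1 \<le> k"
  shows "1/2 \<le> vnorm p w" "vnorm p w \<le> 2"
proof -
  have "(16::real) ^ 1 \<le> 16 ^ k" using assms(2) by (intro power_increasing) auto
  then have "1 / 16 ^ k \<le> (1/16::real)" by (simp add: field_simps)
  moreover obtain v where v: "v \<in> unit_sphere p" "w = grid_round p k v"
    using assms(1) by (auto simp: sphere_net_def)
  moreover note vnorm_grid_round_bounds[OF v(1), of k, folded v(2)]
  ultimately have "1/2 \<le> vnorm p w \<and> vnorm p w \<le> 2" by linarith
  then show "1/2 \<le> vnorm p w" "vnorm p w \<le> 2" by auto
qed

lemma close_pairs_card: "finite (close_pairs k)" "real (card (close_pairs k)) \<le> exp ((6 * real k + 9) * real p)"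
proof -
  have sub: "close_pairs k \<subseteq> sphere_net p (Suc k) \<times> sphere_net p k" by (auto simp: close_pairs_def)
  have fin: "finite (sphere_net p (Suc k) \<times> sphere_net p k)" using sphere_net_card(1)[OF p] by simp
  show "finite (close_pairs k)" using sub fin by (rule finite_subset)
  have "real (card (close_pairs k)) \<le> real (card (sphere_net p (Suc k))) * real (card (sphere_net p k))"
    using card_mono[OF fin sub] by (simp add: card_cartesian_product flip: of_nat_mult)
  also have "\<dots> \<le> exp (3 * (real (Suc k) + 1) * real p) * exp (3 * (real k + 1) * real p)"
    by (intro mult_mono sphere_net_card[OF p]) auto
  also have "\<dots> = exp ((6 * real k + 9) * real p)"
    by (simp add: algebra_simps flip: exp_add)
  finally show "real (card (close_pairs k)) \<le> exp ((6 * real k + 9) * real p)" .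
qed

lemma card_Un_image_le:
  assumes "finite A" "real (card A) \<le> c"
  shows "finite (f ` A \<union> g ` A)" "real (card (f ` A \<union> g ` A)) \<le> 2 * c"
proof -
  have "card (f ` A \<union> g ` A) \<le> card A + card A"
    using card_Un_le[of "f ` A" "g ` A"] card_image_le[OF assms(1), of f] card_image_le[OF assms(1), of g] by linarith
  then show "real (card (f ` A \<union> g ` A)) \<le> 2 * c" using assms(2) by linarith
qed (use assms in simp)

lemma chain_family_card:
  shows "finite (chain_family K k)" "real (card (chain_family K k)) \<le> 2 * exp ((6 * real k + 9) * real p)"
proof -
  have "exp (3 * (real 1 + 1) * real p) \<le> exp ((6 * real 0 + 9) * real p)" using p by simp
  then have N1: "real (card (sphere_net p 1)) \<le> exp ((6 * real 0 + 9) * real p)"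
    using sphere_net_card(2)[OF p, of 1] by linarith
  have "3 * (real k + 1) * real p \<le> (6 * real k + 9) * real p" by (intro mult_right_mono) auto
  then have Nk: "real (card (sphere_net p k)) \<le> exp ((6 * real k + 9) * real p)"
    using sphere_net_card(2)[OF p, of k] by (meson exp_le_cancel_iff order.trans)
  have b: "real (card (band (1 / 4 ^ k) ` sphere_net p k)) \<le> 2 * exp ((6 * real k + 9) * real p)"
    using card_image_le[OF sphere_net_card(1)[OF p, of k], of "band (1 / 4 ^ k)"] Nk
    by (smt (verit) exp_gt_zero of_nat_le_iff)
  show "finite (chain_family K k)"
    unfolding chain_family_def using sphere_net_card(1)[OF p] close_pairs_card(1) by auto
  show "real (card (chain_family K k)) \<le> 2 * exp ((6 * real k + 9) * real p)"
    unfolding chain_family_def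
    using card_Un_image_le(2)[OF sphere_net_card(1)[OF p] N1, of halfspace "\<lambda>w \<omega>. - halfspace w \<omega>"]
      card_Un_image_le(2)[OF close_pairs_card, of "\<lambda>(u, w) \<omega>. halfspace u \<omega> - halfspace w \<omega>" k
        "\<lambda>(u, w) \<omega>. halfspace w \<omega> - halfspace u \<omega>"] b
    by auto
qed

lemma halfspace_diff_square:
  "(halfspace u \<omega> - halfspace w \<omega>)\<^sup>2 = \<bar>halfspace u \<omega> - halfspace w \<omega>\<bar>"
  by (simp add: halfspace_def of_bool_def)

text \<open>The square of a difference of indicators is its absolute value. For a close pair the
  estimate \<open>4 a + d / a\<close> with \<open>a = 1 / 4 ^ k\<close> and
  \<open>d = 2 / 16 ^ k\<close> gives \<open>6 / 4 ^ k\<close>; the 8 is slack.\<close>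

lemma chain_family_props:
  assumes f: "f \<in> chain_family K k"
  shows "f \<in> borel_measurable \<mu>" "\<bar>f \<omega>\<bar> \<le> 1" "(\<integral>\<omega>. (f \<omega>)\<^sup>2 \<partial>\<mu>) \<le> 8 / 4 ^ k"
proof -
  consider (base) w where "k = 0" "f = halfspace w \<or> f = (\<lambda>\<omega>. - halfspace w \<omega>)"
    | (pair) u w where "1 \<le> k" "(u, w) \<in> close_pairs k"
        "f = (\<lambda>\<omega>. halfspace u \<omega> - halfspace w \<omega>) \<or> f = (\<lambda>\<omega>. halfspace w \<omega> - halfspace u \<omega>)"
    | (band) w where "1 \<le> k" "w \<in> sphere_net p k" "f = band (1 / 4 ^ k) w"
    using f unfolding chain_family_def by (auto split: if_splits)
  then have "f \<in> borel_measurable \<mu> \<and> (\<forall>\<omega>. \<bar>f \<omega>\<bar> \<le> 1) \<and> (\<integral>\<omega>. (f \<omega>)\<^sup>2 \<partial>\<mu>) \<le> 8 / 4 ^ k"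
  proof cases
    case base
    have m: "f \<in> borel_measurable \<mu>" using base by auto
    moreover have bd: "\<bar>f \<omega>\<bar> \<le> 1" for \<omega> using base by (auto simp: halfspace_def)
    moreover have "(\<integral>\<omega>. (f \<omega>)\<^sup>2 \<partial>\<mu>) \<le> 1"
    proof (rule integral_le_const)
      show "integrable \<mu> (\<lambda>\<omega>. (f \<omega>)\<^sup>2)" using m bd by (intro integrable_const_bound[where B = 1]) (auto simp: abs_square_le_1)
    qed (use bd in \<open>auto simp: abs_square_le_1\<close>)
    ultimately show ?thesis using base by simp
  next
    case pair
    have w: "w \<in> sphere_net p k" and uw: "vnorm p (vsub p u w) \<le> 2 / 16 ^ k"
      using pair by (auto simp: close_pairs_def)
    have sq: "(f \<omega>)\<^sup>2 = \<bar>halfspace u \<omega> - halfspace w \<omega>\<bar>" for \<omega>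
      using pair halfspace_diff_square[of u \<omega> w] by (auto simp: power2_commute)
    have "(\<integral>\<omega>. (f \<omega>)\<^sup>2 \<partial>\<mu>) \<le> 4 * (1 / 4 ^ k) + vnorm p (vsub p u w) / (1 / 4 ^ k)"
      unfolding sq using sphere_net_norm[OF w] pair by (intro expectation_halfspace_diff) auto
    also have "vnorm p (vsub p u w) / (1 / 4 ^ k) \<le> 2 / 16 ^ k / (1 / 4 ^ k)"
      using uw by (intro divide_right_mono) auto
    also have "2 / 16 ^ k / (1 / 4 ^ k) = (2 / 4 ^ k :: real)"
    proof -
      have "(16::real) ^ k = 4 ^ k * 4 ^ k" by (simp flip: power_mult_distrib)
      then show ?thesis by simp
    qed
    also have "4 * (1 / 4 ^ k) + 2 / 4 ^ k \<le> (8 / 4 ^ k :: real)" by (simp add: field_simps)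
    finally show ?thesis using pair by (auto simp: halfspace_def)
  next
    case band
    have "(f \<omega>)\<^sup>2 = band (1 / 4 ^ k) w \<omega>" for \<omega> using band by (simp add: band_def)
    then have "(\<integral>\<omega>. (f \<omega>)\<^sup>2 \<partial>\<mu>) \<le> 4 * (1 / 4 ^ k)"
      using expectation_band(2)[OF sphere_net_norm(1)[OF band(2,1)], of "1 / 4 ^ k"] by simp
    also have "\<dots> \<le> 8 / 4 ^ k" by (simp add: field_simps)
    finally show ?thesis using band by (auto simp: band_def)
  qed
  then show "f \<in> borel_measurable \<mu>" "\<bar>f \<omega>\<bar> \<le> 1" "(\<integral>\<omega>. (f \<omega>)\<^sup>2 \<partial>\<mu>) \<le> 8 / 4 ^ k" by auto
qed

text \<open>The value of \<open>B\<close> makes \<open>exp (9 - B)\<close> equal to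
  \<open>\<alpha> / 5\<close>. Level \<open>k\<close> fails with probability at most
  \<open>2 * (\<alpha> / 5) * exp (- k)\<close>, in total at most \<open>4 * \<alpha> / 5\<close>,
  and the sums of absolute projections take the remaining fifth.\<close>

lemma good_event:
  fixes n K :: nat
  assumes pn: "p \<le> n" and \<alpha>: "0 < \<alpha>" "\<alpha> < 1"
  defines "M \<equiv> \<Pi>\<^sub>M i\<in>{..<n}. \<mu>" and "B \<equiv> 9 + ln (5 / \<alpha>)"
  obtains G where "G \<in> sets M" "1 - \<alpha> \<le> measure M G"
    "\<And>S k f. S \<in> G \<Longrightarrow> k \<le> K \<Longrightarrow> f \<in> chain_family K k \<Longrightarrow> emp_mean n S f \<le> (\<integral>\<omega>. f \<omega> \<partial>\<mu>) + chain_dev n p B k"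
    "\<And>S w. S \<in> G \<Longrightarrow> w \<in> sphere_net p 1 \<Longrightarrow> (\<Sum>i<n. \<bar>proj w (S i)\<bar>) \<le> real n * (9 + B)"
proof -
  interpret M: prob_space M unfolding M_def by (intro prob_space_PiM prob_space_axioms)
  have n: "0 < n" using p pn by simp
  have "0 < ln (5 / \<alpha>)" using \<alpha> by (intro ln_gt_zero) (simp add: field_simps)
  then have B: "9 < B" by (simp add: B_def)
  have eB: "exp (9 - B) = \<alpha> / 5" using \<alpha> by (simp add: B_def exp_minus)
  define A where "A = (\<lambda>k. {S \<in> space M. \<exists>f\<in>chain_family K k.
      (\<integral>\<omega>. f \<omega> \<partial>\<mu>) + (2 * sqrt (8 / 4 ^ k * ((7 * real k + B) * real p) / real n)
        + 2 * ((7 * real k + B) * real p) / real n) \<le> emp_mean n S f})"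
  have \<tau>: "0 < (7 * real k + B) * real p" for k using B p by (intro mult_pos_pos) auto
  have A_sets: "A k \<in> sets M" for k
    unfolding A_def M_def by (rule iid_bernstein_family(1)[OF prob_space_axioms chain_family_card(1) n \<tau>]) (auto dest: chain_family_props)
  have "measure M (A k) \<le> real (card (chain_family K k)) * exp (- ((7 * real k + B) * real p))" for k
    unfolding A_def M_def by (rule iid_bernstein_family(2)[OF prob_space_axioms chain_family_card(1) n \<tau>]) (auto dest: chain_family_props)
  also have "\<dots> k \<le> 2 * (\<alpha> / 5) * exp (-1) ^ k" for k
  proof -
    have "real (card (chain_family K k)) * exp (- ((7 * real k + B) * real p))
        \<le> 2 * exp ((6 * real k + 9) * real p) * exp (- ((7 * real k + B) * real p))"
      by (intro mult_right_mono chain_family_card) auto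
    also have "\<dots> = 2 * exp (- ((real k + (B - 9)) * real p))"
      by (simp add: algebra_simps flip: exp_add)
    also have "\<dots> \<le> 2 * exp (- ((real k + (B - 9)) * 1))"
    proof -
      have "(real k + (B - 9)) * 1 \<le> (real k + (B - 9)) * real p"
        using p B by (intro mult_left_mono) auto
      then have "exp (- ((real k + (B - 9)) * real p)) \<le> exp (- ((real k + (B - 9)) * 1))"
        by (simp only: exp_le_cancel_iff neg_le_iff_le)
      then show ?thesis by (rule mult_left_mono) simp
    qed
    also have "\<dots> = 2 * (exp (9 - B) * exp (-1) ^ k)"
      by (simp flip: exp_add exp_of_nat_mult)
    finally show ?thesis by (simp add: eB)
  qed
  finally have A_le: "measure M (A k) \<le> 2 * (\<alpha> / 5) * exp (-1) ^ k" for k .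
  \<comment> \<open>In the threshold \<open>9 + B\<close>, 3 pays for the exponential moment and 6
    for the size of the net, which is at most \<open>exp (6 * p) \<le> exp (6 * n)\<close>; the
    surplus \<open>B\<close> gives the probability.\<close>
  define E where "E = (\<lambda>w. {S \<in> space M. real n * (9 + B) \<le> (\<Sum>i<n. \<bar>proj w (S i)\<bar>)})"
  have E_sets: "E w \<in> sets M" for w unfolding E_def M_def by measurable
  have E_le: "measure M (E w) \<le> exp (real n * 3 - real n * (9 + B))" if "w \<in> sphere_net p 1" for w
    unfolding E_def M_def
    using sphere_net_norm[OF that] by (intro iid_chernoff nn_integral_exp_abs_proj prob_space_axioms) auto
  define N where "N = sphere_net p 1"
  have N: "finite N" "real (card N) \<le> exp (6 * real p)"
    unfolding N_def using sphere_net_card[OF p, of 1] by (auto simp: mult.assoc)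
  have UA: "(\<Union>k\<le>K. A k) \<in> sets M" "(\<Union>w\<in>N. E w) \<in> sets M"
    using A_sets E_sets N by (auto intro!: sets.finite_UN)
  have "measure M (\<Union>k\<le>K. A k) \<le> (\<Sum>k\<le>K. measure M (A k))"
    using A_sets by (intro M.finite_measure_subadditive_finite) auto
  also have "\<dots> \<le> (\<Sum>k\<le>K. 2 * (\<alpha> / 5) * exp (-1) ^ k)" by (intro sum_mono A_le)
  also have "\<dots> = 2 * (\<alpha> / 5) * (\<Sum>k<Suc K. exp (-1) ^ k)" by (simp add: sum_distrib_left lessThan_Suc_atMost)
  also have "(\<Sum>k<Suc K. exp (-1) ^ k) \<le> (2::real)"
  proof -
    have e: "exp (-1) \<le> (1/2::real)" using exp_ge_add_one_self[of 1] by (simp add: exp_minus field_simps)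
    have "(\<Sum>k<Suc K. exp (-1) ^ k) \<le> (\<Sum>k<Suc K. (1/2::real) ^ k)" by (intro sum_mono power_mono e) auto
    also have "\<dots> \<le> 2" by (subst sum_gp_strict) auto
    finally show ?thesis .
  qed
  finally have 1: "measure M (\<Union>k\<le>K. A k) \<le> 4 * (\<alpha> / 5)" using \<alpha> by simp
  have "measure M (\<Union>w\<in>N. E w) \<le> (\<Sum>w\<in>N. measure M (E w))"
    using E_sets N by (intro M.finite_measure_subadditive_finite) auto
  also have "\<dots> \<le> (\<Sum>w\<in>N. exp (real n * 3 - real n * (9 + B)))" by (intro sum_mono E_le) (simp add: N_def)
  also have "\<dots> = real (card N) * exp (real n * 3 - real n * (9 + B))" by simp
  also have "\<dots> \<le> exp (6 * real p) * exp (real n * 3 - real n * (9 + B))"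
    by (intro mult_right_mono N) auto
  also have "\<dots> \<le> exp (6 * real n) * exp (real n * 3 - real n * (9 + B))"
    using pn by (intro mult_right_mono) auto
  also have "\<dots> = exp (- (B * real n))" by (simp add: algebra_simps flip: exp_add)
  also have "\<dots> \<le> exp (9 - B)"
  proof -
    have "B * 1 \<le> B * real n" using B n by (intro mult_left_mono) auto
    then have "- (B * real n) \<le> 9 - B" by simp
    then show ?thesis by simp
  qed
  finally have 2: "measure M (\<Union>w\<in>N. E w) \<le> \<alpha> / 5" by (simp add: eB)
  define G where "G = space M - ((\<Union>k\<le>K. A k) \<union> (\<Union>w\<in>N. E w))"
  show ?thesis
  proof (rule that[of G])
    show "G \<in> sets M" unfolding G_def using UA by auto
    have "measure M G = 1 - measure M ((\<Union>k\<le>K. A k) \<union> (\<Union>w\<in>N. E w))"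
      unfolding G_def using UA by (intro M.prob_compl) auto
    moreover have "measure M ((\<Union>k\<le>K. A k) \<union> (\<Union>w\<in>N. E w)) \<le> measure M (\<Union>k\<le>K. A k) + measure M (\<Union>w\<in>N. E w)"
      using UA by (intro measure_Un_le) auto
    ultimately show "1 - \<alpha> \<le> measure M G" using 1 2 by simp
  next
    fix S k f assume S: "S \<in> G" and k: "k \<le> K" and f: "f \<in> chain_family K k"
    then have "S \<notin> A k" "S \<in> space M" by (auto simp: G_def)
    then show "emp_mean n S f \<le> (\<integral>\<omega>. f \<omega> \<partial>\<mu>) + chain_dev n p B k"
      using f unfolding A_def chain_dev_def by force
  next
    fix S w assume S: "S \<in> G" and w: "w \<in> sphere_net p 1"
    then have "S \<notin> E w" "S \<in> space M" by (auto simp: G_def N_def)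
    then show "(\<Sum>i<n. \<bar>proj w (S i)\<bar>) \<le> real n * (9 + B)"
      unfolding E_def by simp
  qed
qed

lemma uniform_deviation:
  fixes n :: nat
  assumes pn: "p \<le> n" and \<alpha>: "0 < \<alpha>" "\<alpha> < 1"
  defines "M \<equiv> \<Pi>\<^sub>M i\<in>{..<n}. \<mu>"
  obtains G where "G \<in> sets M" "1 - \<alpha> \<le> measure M G"
    "\<And>S v. S \<in> G \<Longrightarrow> v \<in> unit_sphere p \<Longrightarrow>
       \<bar>emp_mean n S (halfspace v) - (\<integral>\<omega>. halfspace v \<omega> \<partial>\<mu>)\<bar> \<le> (800 + 50 * ln (5 / \<alpha>)) * sqrt (real p / real n)"
proof -
  define B where "B = 9 + ln (5 / \<alpha>)"
  have n: "0 < n" using p pn by simp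
  have "0 < ln (5 / \<alpha>)" using \<alpha> by (intro ln_gt_zero) (simp add: field_simps)
  then have B: "9 < B" by (simp add: B_def)
  have "1 \<le> real n / real p" using pn p by simp
  then obtain K where K: "1 \<le> K" "16 ^ (K - 1) \<le> real n / real p" "real n / real p \<le> 16 ^ K"
    by (rule ex_scale)
  obtain G where G: "G \<in> sets M" "1 - \<alpha> \<le> measure M G"
    and chain: "\<And>S k f. S \<in> G \<Longrightarrow> k \<le> K \<Longrightarrow> f \<in> chain_family K k \<Longrightarrow> emp_mean n S f \<le> (\<integral>\<omega>. f \<omega> \<partial>\<mu>) + chain_dev n p B k"
    and net: "\<And>S w. S \<in> G \<Longrightarrow> w \<in> sphere_net p 1 \<Longrightarrow> (\<Sum>i<n. \<bar>proj w (S i)\<bar>) \<le> real n * (9 + B)"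
    using good_event[OF pn \<alpha>, of K] unfolding M_def B_def by blast
  \<comment> \<open>The square root of the last scale, so that the band term of order
    \<open>a\<close> balances the remainder term of order \<open>(1 / 16 ^ K) / a\<close>. By the
    choice of \<open>K\<close> it is at most \<open>sqrt (p / n)\<close>.\<close>
  define a :: real where "a = 1 / 4 ^ K"
  have a: "0 < a" by (simp add: a_def)
  have aa: "1 / 16 ^ K = a * a" by (simp add: a_def flip: power_mult_distrib)
  have ar: "a \<le> sqrt (real p / real n)"
  proof (rule real_le_rsqrt)
    have "a\<^sup>2 = 1 / 16 ^ K" by (simp add: aa power2_eq_square)
    also have "\<dots> \<le> 1 / (real n / real p)"
      using K(3) n p by (intro divide_left_mono) auto
    finally show "a\<^sup>2 \<le> real p / real n" by simp
  qed
  show ?thesis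
  proof (rule that[OF G])
    fix S v assume S: "S \<in> G" and v: "v \<in> unit_sphere p"
    define w where "w = (\<lambda>k. grid_round p k v)"
    have wN: "w k \<in> sphere_net p k" for k using v by (simp add: w_def sphere_net_def)
    have vw: "vnorm p (vsub p v (w k)) \<le> 1 / 16 ^ k" for k
      unfolding w_def by (rule vnorm_grid_round_le)
    define D where "D = (\<lambda>u. emp_mean n S (halfspace u) - (\<integral>\<omega>. halfspace u \<omega> \<partial>\<mu>))"
    \<comment> \<open>Telescoping along the roundings. Level 0 of the family controls the half space
      of \<open>w 1\<close>, which explains the shift between \<open>Suc j\<close> on the left and
      \<open>j\<close> on the right.\<close>
    have D_w: "\<bar>D (w (Suc j))\<bar> \<le> (\<Sum>k\<le>j. chain_dev n p B k)" if "j < K" for j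
      using that
    proof (induction j)
      case 0
      have "halfspace (w 1) \<in> chain_family K 0" "(\<lambda>\<omega>. - halfspace (w 1) \<omega>) \<in> chain_family K 0"
        using wN[of 1] by (auto simp: chain_family_def)
      from chain[OF S _ this(1)] chain[OF S _ this(2)]
      show ?case by (auto simp: D_def emp_mean_def sum_negf)
    next
      case (Suc j)
      have "vnorm p (vsub p (w (Suc (Suc j))) (w (Suc j))) \<le> 1 / 16 ^ Suc (Suc j) + 1 / 16 ^ Suc j"
        using vnorm_vsub_triangle[of p "w (Suc (Suc j))" "w (Suc j)" v] vw[of "Suc j"] vw[of "Suc (Suc j)"]
        by (simp add: vnorm_vsub_commute)
      also have "\<dots> \<le> 2 / 16 ^ Suc j" by (simp add: field_simps)
      finally have "(w (Suc (Suc j)), w (Suc j)) \<in> close_pairs (Suc j)"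
        using wN by (simp add: close_pairs_def)
      then have "(\<lambda>\<omega>. halfspace (w (Suc (Suc j))) \<omega> - halfspace (w (Suc j)) \<omega>) \<in> chain_family K (Suc j)"
        "(\<lambda>\<omega>. halfspace (w (Suc j)) \<omega> - halfspace (w (Suc (Suc j))) \<omega>) \<in> chain_family K (Suc j)"
        using Suc.prems by (force simp: chain_family_def)+
      from chain[OF S _ this(1)] chain[OF S _ this(2)] Suc.prems
      have "\<bar>D (w (Suc (Suc j))) - D (w (Suc j))\<bar> \<le> chain_dev n p B (Suc j)"
        by (simp add: D_def emp_mean_diff integrable_halfspace abs_le_iff)
      moreover have "\<bar>D (w (Suc j))\<bar> \<le> (\<Sum>k\<le>j. chain_dev n p B k)" using Suc by simp
      ultimately show ?case by simp
    qed
    obtain j where j: "K = Suc j" using K(1) by (cases K) auto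
    have "band a (w K) \<in> chain_family K K" using wN K(1) by (simp add: chain_family_def a_def)
    from chain[OF S _ this]
    have bandS: "emp_mean n S (band a (w K)) \<le> 4 * a + chain_dev n p B K"
      using expectation_band(2)[OF sphere_net_norm(1)[OF wN K(1)], of a] a by simp
    \<comment> \<open>The last link runs over all unit vectors, so no union bound is available. The
      uniform bound on empirical absolute projections replaces it, at the price of the factor
      \<open>1 / 16 ^ K\<close>-small norm being divided by \<open>a\<close> only
      afterwards.\<close>
    have "(\<Sum>i<n. \<bar>proj (vsub p v (w K)) (S i)\<bar>) \<le> 2 * (real n * (9 + B)) * vnorm p (vsub p v (w K))"
      unfolding proj_def by (rule sum_abs_dotp_le_net[OF p]) (use net[OF S] in \<open>simp add: proj_def\<close>)
    also have "\<dots> \<le> 2 * (real n * (9 + B)) * (a * a)"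
      using vw[of K] B unfolding aa by (intro mult_left_mono) auto
    finally have F: "(\<Sum>i<n. \<bar>proj (vsub p v (w K)) (S i)\<bar>) / real n \<le> 2 * (9 + B) * (a * a)"
      using n by (simp add: divide_le_eq mult_ac)
    have "emp_mean n S (\<lambda>\<omega>. \<bar>proj (vsub p v (w K)) \<omega>\<bar> / a)
        = (\<Sum>i<n. \<bar>proj (vsub p v (w K)) (S i)\<bar>) / real n / a"
      by (simp add: emp_mean_def mult.commute flip: sum_divide_distrib)
    then have opS: "emp_mean n S (\<lambda>\<omega>. \<bar>proj (vsub p v (w K)) \<omega>\<bar> / a) \<le> 2 * (9 + B) * a"
      using divide_right_mono[OF F, of a] a by simp
    have "\<bar>emp_mean n S (halfspace v) - emp_mean n S (halfspace (w K))\<bar>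
        \<le> emp_mean n S (\<lambda>\<omega>. \<bar>halfspace v \<omega> - halfspace (w K) \<omega>\<bar>)"
      unfolding emp_mean_diff[symmetric] by (rule emp_mean_abs)
    also have "\<dots> \<le> emp_mean n S (\<lambda>\<omega>. band a (w K) \<omega> + \<bar>proj (vsub p v (w K)) \<omega>\<bar> / a)"
      by (intro emp_mean_mono halfspace_diff_le a)
    also have "\<dots> \<le> 4 * a + chain_dev n p B K + 2 * (9 + B) * a"
      unfolding emp_mean_add using bandS opS by simp
    finally have 1: "\<bar>emp_mean n S (halfspace v) - emp_mean n S (halfspace (w K))\<bar> \<le> \<dots>" .
    have "\<bar>(\<integral>\<omega>. halfspace v \<omega> \<partial>\<mu>) - (\<integral>\<omega>. halfspace (w K) \<omega> \<partial>\<mu>)\<bar>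
        = \<bar>\<integral>\<omega>. halfspace v \<omega> - halfspace (w K) \<omega> \<partial>\<mu>\<bar>"
      by (simp add: integrable_halfspace)
    also have "\<dots> \<le> (\<integral>\<omega>. \<bar>halfspace v \<omega> - halfspace (w K) \<omega>\<bar> \<partial>\<mu>)" by (rule integral_abs_bound)
    also have "\<dots> \<le> 4 * a + vnorm p (vsub p v (w K)) / a"
      by (rule expectation_halfspace_diff[OF sphere_net_norm(1)[OF wN K(1)] a])
    also have "vnorm p (vsub p v (w K)) / a \<le> a"
      using vw[of K] a unfolding aa by (simp add: divide_le_eq)
    finally have 2: "\<bar>(\<integral>\<omega>. halfspace v \<omega> \<partial>\<mu>) - (\<integral>\<omega>. halfspace (w K) \<omega> \<partial>\<mu>)\<bar> \<le> 5 * a" by simp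
    have "\<bar>D v\<bar> \<le> \<bar>D (w K)\<bar> + (4 * a + chain_dev n p B K + 2 * (9 + B) * a) + 5 * a"
      using 1 2 unfolding D_def by linarith
    also have "\<dots> \<le> (\<Sum>k\<le>K. chain_dev n p B k) + (27 + 2 * B) * a"
      using D_w[of j] by (simp add: j algebra_simps)
    also have "\<dots> \<le> (308 + 44 * B) * sqrt (real p / real n) + (27 + 2 * B) * sqrt (real p / real n)"
      using ar B by (intro add_mono sum_chain_dev_le[OF p pn _ K(1,2)] mult_left_mono) auto
    also have "\<dots> = (335 + 46 * B) * sqrt (real p / real n)" by (simp add: algebra_simps)
    \<comment> \<open>With \<open>B = 9 + ln (5 / \<alpha>)\<close> the constant part is
      \<open>335 + 46 * 9 = 749\<close>.\<close>
    also have "\<dots> \<le> (800 + 50 * ln (5 / \<alpha>)) * sqrt (real p / real n)"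
      using \<open>0 < ln (5 / \<alpha>)\<close> by (intro mult_right_mono) (auto simp: B_def)
    finally show "\<bar>emp_mean n S (halfspace v) - (\<integral>\<omega>. halfspace v \<omega> \<partial>\<mu>)\<bar> \<le> (800 + 50 * ln (5 / \<alpha>)) * sqrt (real p / real n)"
      by (simp add: D_def)
  qed
qed

end

section \<open>Depth under adaptive contamination\<close>

text \<open>Rectangles do not suffice, because the events of interest couple covariate and response
  through the residual.\<close>

lemma emeasure_obs_law_slices:
  assumes m: "adaptive_contamination_model n p \<epsilon> \<beta> \<sigma> Q"
    and C: "C \<in> sets (borel_vec p \<Otimes>\<^sub>M borel)"
  shows "emeasure (obs_law p \<epsilon> \<beta> \<sigma> Q) C =
    (\<integral>\<^sup>+x. (ennreal (1 - \<epsilon>) * emeasure (normal_law (dotp p x \<beta>) \<sigma>) (Pair x -` C)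
        + ennreal \<epsilon> * emeasure (Q x) (Pair x -` C)) \<partial>std_gaussian_vec p)"
proof -
  have R: "response_law p \<epsilon> \<beta> \<sigma> Q x \<in> space (prob_algebra borel)" if "x \<in> space (borel_vec p)" for x
    using measurable_space [OF response_law_measurable [OF m] that] .
  show ?thesis
    unfolding obs_law_def
    unfolding emeasure_bind_prob_algebra [OF std_gaussian_vec_in obs_kernel_measurable [OF m] C]
  proof (intro nn_integral_cong)
    fix x assume "x \<in> space (std_gaussian_vec p)"
    then have x: "x \<in> space (borel_vec p)" by (simp add: space_std_gaussian_vec space_borel_vec)
    have slice: "Pair x -` C \<in> sets borel" using C by (rule sets_Pair1)
    have [measurable]: "(\<lambda>y. return (borel_vec p \<Otimes>\<^sub>M borel) (x, y))
        \<in> (borel :: real measure) \<rightarrow>\<^sub>M prob_algebra (borel_vec p \<Otimes>\<^sub>M borel)"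
      using x by measurable
    have "emeasure (response_law p \<epsilon> \<beta> \<sigma> Q x \<bind> (\<lambda>y. return (borel_vec p \<Otimes>\<^sub>M borel) (x, y))) C
        = (\<integral>\<^sup>+y. emeasure (return (borel_vec p \<Otimes>\<^sub>M borel) (x, y)) C \<partial>response_law p \<epsilon> \<beta> \<sigma> Q x)"
      by (rule emeasure_bind_prob_algebra [OF R [OF x] _ C]) measurable
    also have "\<dots> = (\<integral>\<^sup>+y. indicator (Pair x -` C) y \<partial>response_law p \<epsilon> \<beta> \<sigma> Q x)"
      using C by (simp add: indicator_def)
    also have "\<dots> = emeasure (response_law p \<epsilon> \<beta> \<sigma> Q x) (Pair x -` C)"
      using R [OF x] slice by (intro nn_integral_indicator) (simp add: space_prob_algebra)
    also have "\<dots> = ennreal (1 - \<epsilon>) * emeasure (normal_law (dotp p x \<beta>) \<sigma>) (Pair x -` C)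
        + ennreal \<epsilon> * emeasure (Q x) (Pair x -` C)"
      using x slice by (intro emeasure_response_law[OF m]) (simp_all add: space_borel_vec)
    finally show "emeasure (response_law p \<epsilon> \<beta> \<sigma> Q x \<bind> (\<lambda>y. return (borel_vec p \<Otimes>\<^sub>M borel) (x, y))) C
      = ennreal (1 - \<epsilon>) * emeasure (normal_law (dotp p x \<beta>) \<sigma>) (Pair x -` C)
        + ennreal \<epsilon> * emeasure (Q x) (Pair x -` C)" .
  qed
qed

lemma std_gaussian_two_sided_tail:
  assumes v: "v \<in> unit_sphere p" and t: "0 < t"
  shows "emeasure (std_gaussian_vec p) {x \<in> space (std_gaussian_vec p). t \<le> \<bar>dotp p v x\<bar>} = ennreal (2 * gauss_tail t)"
proof -
  interpret prob_space "normal_law 0 1" by (rule prob_space_normal_law) simp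
  have v1: "vnorm p v = 1" by (rule vnorm_unit_sphere[OF v])
  have "emeasure (std_gaussian_vec p) {x \<in> space (std_gaussian_vec p). t \<le> \<bar>dotp p v x\<bar>}
      = emeasure (distr (std_gaussian_vec p) borel (dotp p v)) {x. t \<le> \<bar>x\<bar>}"
    by (subst emeasure_distr) (auto intro!: arg_cong[where f = "emeasure _"])
  also have "\<dots> = emeasure (normal_law 0 1) {x. t \<le> \<bar>x\<bar>}"
    using dotp_std_gaussian[of p v] v1 by simp
  finally show ?thesis using gauss_tail_two_sided[OF t] by (simp add: emeasure_eq_measure)
qed

locale contaminated_regression =
  fixes n p :: nat and \<epsilon> :: real and \<beta> :: vec and \<sigma> :: real and Q :: "vec \<Rightarrow> real measure" and t :: real
  assumes model: "adaptive_contamination_model n p \<epsilon> \<beta> \<sigma> Q" and t_pos: "0 < t"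
begin

abbreviation \<mu> :: "(vec \<times> real) measure" where
  "\<mu> \<equiv> obs_law p \<epsilon> \<beta> \<sigma> Q"

definition resid :: "vec \<times> real \<Rightarrow> real" where
  "resid z = snd z - dotp p (fst z) \<beta>"

text \<open>Signs that are forgotten below the level \<open>s\<close>. At \<open>s = 0\<close> the half spaces of the signed
  covariates lie inside the depth events at \<open>\<beta>\<close>; at \<open>s > 0\<close> they contain the depth events at
  any point whose distance to \<open>\<beta>\<close> exceeds \<open>s / t\<close>, when tested in the direction of that point.\<close>

definition trunc_sign :: "real \<Rightarrow> vec \<times> real \<Rightarrow> real" where
  "trunc_sign s z = (if \<bar>resid z\<bar> < s then 0 else sgn (resid z))"

lemma params: "1 \<le> n" "1 \<le> p" "0 \<le> \<epsilon>" "\<epsilon> < 1/2" "\<beta> \<in> Rvec p" "0 < \<sigma>"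
  using model by (auto simp: adaptive_contamination_model_def)

lemma prob_space_obs: "prob_space \<mu>" and sets_obs [measurable_cong]: "sets \<mu> = sets (borel_vec p \<Otimes>\<^sub>M borel)"
  using obs_law_in[OF model] by (auto simp: space_prob_algebra)

lemma space_obs: "space \<mu> = Rvec p \<times> UNIV"
  using sets_eq_imp_space_eq[OF sets_obs] by (simp add: space_pair_measure space_borel_vec)

lemma resid_measurable [measurable]: "resid \<in> borel_measurable \<mu>"
  unfolding resid_def by measurable

lemma trunc_sign_measurable [measurable]: "trunc_sign s \<in> borel_measurable \<mu>"
  unfolding trunc_sign_def by measurable

text \<open>Every conditional law of the response has total mass 1, contaminated or not, so the
  covariate keeps its Gaussian law.\<close>

lemma distr_fst_obs: "distr \<mu> (borel_vec p) fst = std_gaussian_vec p"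
proof (rule measure_eqI)
  show "sets (distr \<mu> (borel_vec p) fst) = sets (std_gaussian_vec p)"
    by (simp add: sets_std_gaussian_vec)
  fix A assume "A \<in> sets (distr \<mu> (borel_vec p) fst)"
  then have A: "A \<in> sets (borel_vec p)" by simp
  have "A \<subseteq> Rvec p" using sets.sets_into_space[OF A] by (simp add: space_borel_vec)
  then have "emeasure (distr \<mu> (borel_vec p) fst) A = emeasure \<mu> (A \<times> UNIV)"
    using A by (subst emeasure_distr) (auto simp: space_obs intro!: arg_cong[where f = "emeasure \<mu>"])
  also have "\<dots> = (\<integral>\<^sup>+x\<in>A. emeasure (response_law p \<epsilon> \<beta> \<sigma> Q x) UNIV \<partial>std_gaussian_vec p)"
    by (rule emeasure_obs_law[OF model A]) simp
  also have "\<dots> = (\<integral>\<^sup>+x\<in>A. 1 \<partial>std_gaussian_vec p)"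
  proof (intro nn_integral_cong)
    fix x assume "x \<in> space (std_gaussian_vec p)"
    then have "response_law p \<epsilon> \<beta> \<sigma> Q x \<in> space (prob_algebra borel)"
      using measurable_space [OF response_law_measurable [OF model]] by (simp add: space_std_gaussian_vec space_borel_vec)
    then have "prob_space (response_law p \<epsilon> \<beta> \<sigma> Q x)" "space (response_law p \<epsilon> \<beta> \<sigma> Q x) = UNIV"
      by (auto simp: space_prob_algebra dest: sets_eq_imp_space_eq)
    then have "emeasure (response_law p \<epsilon> \<beta> \<sigma> Q x) UNIV = 1"
      using prob_space.emeasure_space_1 by metis
    then show "emeasure (response_law p \<epsilon> \<beta> \<sigma> Q x) UNIV * indicator A x = 1 * indicator A x" by simp
  qed
  also have "\<dots> = emeasure (std_gaussian_vec p) A" using A by (simp add: sets_std_gaussian_vec)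
  finally show "emeasure (distr \<mu> (borel_vec p) fst) A = emeasure (std_gaussian_vec p) A" .
qed

lemma design: "signed_gaussian_design \<mu> p fst (trunc_sign s) t"
proof -
  interpret prob_space \<mu> by (rule prob_space_obs)
  show ?thesis
  proof
    show "fst \<in> \<mu> \<rightarrow>\<^sub>M borel_vec p" by measurable
    show "trunc_sign s \<omega> \<in> {-1, 0, 1}" for \<omega> by (simp add: trunc_sign_def sgn_if)
  qed (use params t_pos distr_fst_obs in auto)
qed

definition signed_half :: "real \<Rightarrow> vec \<Rightarrow> vec \<times> real \<Rightarrow> real" where
  "signed_half s v z = of_bool (t \<le> trunc_sign s z * dotp p v (fst z))"

lemma signed_half_eq: "signed_gaussian_design.halfspace p fst (trunc_sign s) t = signed_half s"
  unfolding signed_gaussian_design.halfspace_def[OF design, abs_def] signed_gaussian_design.proj_def[OF design]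
    signed_half_def[abs_def] ..

lemma expectation_signed_half:
  defines "C s v \<equiv> {z \<in> space \<mu>. t \<le> trunc_sign s z * dotp p v (fst z)}"
  shows "C s v \<in> sets \<mu>" "ennreal (\<integral>z. signed_half s v z \<partial>\<mu>) = emeasure \<mu> (C s v)"
proof -
  interpret prob_space \<mu> by (rule prob_space_obs)
  show C: "C s v \<in> sets \<mu>" unfolding C_def by measurable
  have "(\<integral>z. signed_half s v z \<partial>\<mu>) = (\<integral>z. indicator (C s v) z \<partial>\<mu>)"
    by (intro Bochner_Integration.integral_cong) (auto simp: C_def signed_half_def indicator_def)
  also have "\<dots> = prob (C s v)" using C by simp
  finally show "ennreal (\<integral>z. signed_half s v z \<partial>\<mu>) = emeasure \<mu> (C s v)" by (simp add: emeasure_eq_measure)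
qed

lemma signed_half_nonneg: "0 \<le> (\<integral>z. signed_half s v z \<partial>\<mu>)"
  by (intro integral_nonneg_AE) (simp add: signed_half_def)

lemma tail_set: "{x \<in> space (std_gaussian_vec p). t \<le> \<bar>dotp p v x\<bar>} \<in> sets (std_gaussian_vec p)"
  by measurable

text \<open>The contaminated part is discarded. Under the clean part, given a covariate in the
  two-sided tail of mass \<open>2 * gauss_tail t\<close>, the residual has the right strict sign
  with probability \<open>1/2\<close>.\<close>

lemma signed_half_lower:
  assumes v: "v \<in> unit_sphere p"
  shows "(1 - \<epsilon>) * gauss_tail t \<le> (\<integral>z. signed_half 0 v z \<partial>\<mu>)"
proof -
  let ?A = "{x \<in> space (std_gaussian_vec p). t \<le> \<bar>dotp p v x\<bar>}"
  define C where "C = {z \<in> space \<mu>. t \<le> trunc_sign 0 z * dotp p v (fst z)}"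
  have C: "C \<in> sets (borel_vec p \<Otimes>\<^sub>M borel)"
    using expectation_signed_half(1)[of 0 v] by (simp add: C_def sets_obs)
  have "ennreal ((1 - \<epsilon>) * gauss_tail t) = (\<integral>\<^sup>+x\<in>?A. ennreal ((1 - \<epsilon>) / 2) \<partial>std_gaussian_vec p)"
    using params tail_set by (simp add: nn_integral_cmult_indicator std_gaussian_two_sided_tail[OF v t_pos] gauss_tail_def
        flip: ennreal_mult)
  also have "\<dots> \<le> (\<integral>\<^sup>+x. (ennreal (1 - \<epsilon>) * emeasure (normal_law (dotp p x \<beta>) \<sigma>) (Pair x -` C)
        + ennreal \<epsilon> * emeasure (Q x) (Pair x -` C)) \<partial>std_gaussian_vec p)"
  proof (intro nn_integral_mono)
    fix x assume x: "x \<in> space (std_gaussian_vec p)"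
    interpret N: prob_space "normal_law (dotp p x \<beta>) \<sigma>" by (intro prob_space_normal_law params)
    have half: "1/2 \<le> measure (normal_law (dotp p x \<beta>) \<sigma>) (Pair x -` C)" if "t \<le> \<bar>dotp p v x\<bar>"
    proof (cases "t \<le> dotp p v x")
      case True
      then have "{y. 0 < y - dotp p x \<beta>} \<subseteq> Pair x -` C"
        using x t_pos by (auto simp: C_def space_obs space_std_gaussian_vec trunc_sign_def resid_def)
      then show ?thesis using normal_law_half(1)[OF params(6), of "dotp p x \<beta>"]
        using sets_Pair1[OF C, of x] N.finite_measure_mono[of "{y. 0 < y - dotp p x \<beta>}" "Pair x -` C"] by (simp add: sets_normal_law)
    next
      case False
      then have "{y. y - dotp p x \<beta> < 0} \<subseteq> Pair x -` C"
        using x t_pos that by (auto simp: C_def space_obs space_std_gaussian_vec trunc_sign_def resid_def)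
      then show ?thesis using normal_law_half(2)[OF params(6), of "dotp p x \<beta>"]
        using sets_Pair1[OF C, of x] N.finite_measure_mono[of "{y. y - dotp p x \<beta> < 0}" "Pair x -` C"] by (simp add: sets_normal_law)
    qed
    show "ennreal ((1 - \<epsilon>) / 2) * indicator ?A x \<le> ennreal (1 - \<epsilon>) * emeasure (normal_law (dotp p x \<beta>) \<sigma>) (Pair x -` C)
        + ennreal \<epsilon> * emeasure (Q x) (Pair x -` C)"
    proof (cases "x \<in> ?A")
      case True
      then have "(1 - \<epsilon>) * (1 / 2) \<le> (1 - \<epsilon>) * measure (normal_law (dotp p x \<beta>) \<sigma>) (Pair x -` C)"
        using half params by (intro mult_left_mono) auto
      then have "ennreal ((1 - \<epsilon>) / 2) \<le> ennreal (1 - \<epsilon>) * emeasure (normal_law (dotp p x \<beta>) \<sigma>) (Pair x -` C)"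
        using params by (simp add: N.emeasure_eq_measure flip: ennreal_mult)
      then show ?thesis using True by (simp add: add_increasing2)
    qed simp
  qed
  also have "\<dots> = emeasure \<mu> C" by (rule emeasure_obs_law_slices[OF model C, symmetric])
  also have "\<dots> = ennreal (\<integral>z. signed_half 0 v z \<partial>\<mu>)"
    unfolding C_def by (rule expectation_signed_half(2)[symmetric])
  finally show ?thesis using signed_half_nonneg by (simp add: ennreal_le_iff)
qed

text \<open>Given a covariate in the two-sided tail, a clean residual reaches size \<open>s\<close>
  with the right sign with probability \<open>gauss_tail (s / \<sigma>)\<close>, and the
  contamination adds at most \<open>\<epsilon>\<close>. Since the covariates are not contaminated,
  \<open>\<epsilon>\<close> too is multiplied by the tail mass; relative to that mass its effect
  does not grow with \<open>t\<close>, which is the source of the term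
  \<open>\<sigma> * \<epsilon> / t\<close>.\<close>

lemma signed_half_upper:
  assumes v: "v \<in> unit_sphere p" and s: "0 < s"
  shows "(\<integral>z. signed_half s v z \<partial>\<mu>) \<le> 2 * gauss_tail t * (gauss_tail (s / \<sigma>) + \<epsilon>)"
proof -
  let ?A = "{x \<in> space (std_gaussian_vec p). t \<le> \<bar>dotp p v x\<bar>}" and ?g = "gauss_tail (s / \<sigma>)"
  define C where "C = {z \<in> space \<mu>. t \<le> trunc_sign s z * dotp p v (fst z)}"
  have C: "C \<in> sets (borel_vec p \<Otimes>\<^sub>M borel)"
    using expectation_signed_half(1)[of s v] by (simp add: C_def sets_obs)
  have g0: "0 \<le> ?g" "0 \<le> gauss_tail t" by (simp_all add: gauss_tail_def)
  have "ennreal (\<integral>z. signed_half s v z \<partial>\<mu>) = emeasure \<mu> C"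
    unfolding C_def by (rule expectation_signed_half(2))
  also have "\<dots> = (\<integral>\<^sup>+x. (ennreal (1 - \<epsilon>) * emeasure (normal_law (dotp p x \<beta>) \<sigma>) (Pair x -` C)
        + ennreal \<epsilon> * emeasure (Q x) (Pair x -` C)) \<partial>std_gaussian_vec p)"
    by (rule emeasure_obs_law_slices[OF model C])
  also have "\<dots> \<le> (\<integral>\<^sup>+x\<in>?A. ennreal (?g + \<epsilon>) \<partial>std_gaussian_vec p)"
  proof (intro nn_integral_mono)
    fix x assume x: "x \<in> space (std_gaussian_vec p)"
    interpret N: prob_space "normal_law (dotp p x \<beta>) \<sigma>" by (intro prob_space_normal_law params)
    have "Q x \<in> space (prob_algebra borel)"
      using model x by (auto simp: adaptive_contamination_model_def space_std_gaussian_vec space_borel_vec dest: measurable_space)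
    then interpret Qx: prob_space "Q x" by (simp add: space_prob_algebra)
    have N_le: "measure (normal_law (dotp p x \<beta>) \<sigma>) (Pair x -` C) \<le> ?g" if "t \<le> \<bar>dotp p v x\<bar>"
    proof (cases "t \<le> dotp p v x")
      case True
      have "Pair x -` C \<subseteq> {y. s \<le> y - dotp p x \<beta>}"
      proof
        fix y assume "y \<in> Pair x -` C"
        then have "t \<le> trunc_sign s (x, y) * dotp p v x" by (simp add: C_def)
        then show "y \<in> {y. s \<le> y - dotp p x \<beta>}"
          using True t_pos s by (auto simp: trunc_sign_def resid_def sgn_if split: if_splits)
      qed
      then show ?thesis using normal_law_upper(1)[OF params(6), of "dotp p x \<beta>" s]
        using N.finite_measure_mono[of "Pair x -` C" "{y. s \<le> y - dotp p x \<beta>}"] by (simp add: sets_normal_law)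
    next
      case False
      have "Pair x -` C \<subseteq> {y. y - dotp p x \<beta> \<le> - s}"
      proof
        fix y assume "y \<in> Pair x -` C"
        then have "t \<le> trunc_sign s (x, y) * dotp p v x" by (simp add: C_def)
        then show "y \<in> {y. y - dotp p x \<beta> \<le> - s}"
          using False t_pos s by (auto simp: trunc_sign_def resid_def sgn_if split: if_splits)
      qed
      then show ?thesis using normal_law_upper(2)[OF params(6), of "dotp p x \<beta>" s]
        using N.finite_measure_mono[of "Pair x -` C" "{y. y - dotp p x \<beta> \<le> - s}"] by (simp add: sets_normal_law)
    qed
    show "ennreal (1 - \<epsilon>) * emeasure (normal_law (dotp p x \<beta>) \<sigma>) (Pair x -` C)
        + ennreal \<epsilon> * emeasure (Q x) (Pair x -` C) \<le> ennreal (?g + \<epsilon>) * indicator ?A x"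
    proof (cases "x \<in> ?A")
      case True
      have "(1 - \<epsilon>) * measure (normal_law (dotp p x \<beta>) \<sigma>) (Pair x -` C) \<le> 1 * ?g"
        using True N_le params g0 by (intro mult_mono) auto
      moreover have "\<epsilon> * measure (Q x) (Pair x -` C) \<le> \<epsilon>"
        using params by (intro mult_left_le) auto
      ultimately have "(1 - \<epsilon>) * measure (normal_law (dotp p x \<beta>) \<sigma>) (Pair x -` C) + \<epsilon> * measure (Q x) (Pair x -` C) \<le> ?g + \<epsilon>"
        by simp
      then have "ennreal ((1 - \<epsilon>) * measure (normal_law (dotp p x \<beta>) \<sigma>) (Pair x -` C) + \<epsilon> * measure (Q x) (Pair x -` C))
          \<le> ennreal (?g + \<epsilon>)" by (rule ennreal_leI)
      then show ?thesis using True params g0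
        by (simp add: N.emeasure_eq_measure Qx.emeasure_eq_measure ennreal_mult)
    next
      case False
      then have "Pair x -` C = {}"
        using x t_pos by (auto simp: C_def trunc_sign_def sgn_if split: if_splits)
      then show ?thesis by simp
    qed
  qed
  also have "\<dots> = ennreal (2 * gauss_tail t * (?g + \<epsilon>))"
  proof -
    have "(\<integral>\<^sup>+x\<in>?A. ennreal (?g + \<epsilon>) \<partial>std_gaussian_vec p) = ennreal (?g + \<epsilon>) * ennreal (2 * gauss_tail t)"
      using tail_set by (simp only: nn_integral_cmult_indicator std_gaussian_two_sided_tail[OF v t_pos])
    also have "\<dots> = ennreal ((?g + \<epsilon>) * (2 * gauss_tail t))"
      using params g0 by (intro ennreal_mult[symmetric]) auto
    finally show ?thesis by (simp only: mult.commute)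
  qed
  finally show ?thesis using params g0 by (simp add: ennreal_le_iff)
qed

end

section \<open>Comparing the depth at the true vector and at distant points\<close>

context contaminated_regression
begin

lemma bdd_below_depth:
  "bdd_below ((\<lambda>v. 1 / real n * (\<Sum>i<n. case S i of (x, y) \<Rightarrow>
     of_bool (dotp p v x * (y - dotp p x b) \<ge> 0 \<and> \<bar>dotp p v x\<bar> \<ge> t))) ` unit_sphere p)"
  by (intro bdd_belowI2[where m = 0] mult_nonneg_nonneg sum_nonneg) (auto split: prod.split)

lemma trunc_depth_ge:
  assumes "\<And>v. v \<in> unit_sphere p \<Longrightarrow> c \<le> emp_mean n S (signed_half 0 v)"
  shows "c \<le> trunc_depth n p \<beta> S t"
  unfolding trunc_depth_def
proof (rule cINF_greatest[OF unit_sphere_nonempty[OF params(2)]])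
  fix v assume v: "v \<in> unit_sphere p"
  have "signed_half 0 v (x, y) \<le> of_bool (dotp p v x * (y - dotp p x \<beta>) \<ge> 0 \<and> \<bar>dotp p v x\<bar> \<ge> t)" for x y
    using t_pos by (auto simp: signed_half_def trunc_sign_def resid_def sgn_if zero_le_mult_iff split: if_splits)
  then have "(\<Sum>i<n. signed_half 0 v (S i))
      \<le> (\<Sum>i<n. case S i of (x, y) \<Rightarrow> of_bool (dotp p v x * (y - dotp p x \<beta>) \<ge> 0 \<and> \<bar>dotp p v x\<bar> \<ge> t))"
    by (intro sum_mono) (auto split: prod.split)
  then have "emp_mean n S (signed_half 0 v) \<le> 1 / real n * (\<Sum>i<n. case S i of (x, y) \<Rightarrow> of_bool (dotp p v x * (y - dotp p x \<beta>) \<ge> 0 \<and> \<bar>dotp p v x\<bar> \<ge> t))"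
    by (simp add: emp_mean_def divide_right_mono)
  with assms[OF v] show "c \<le> 1 / real n * (\<Sum>i<n. case S i of (x, y) \<Rightarrow> of_bool (dotp p v x * (y - dotp p x \<beta>) \<ge> 0 \<and> \<bar>dotp p v x\<bar> \<ge> t))"
    by linarith
qed

lemma trunc_depth_le:
  assumes b: "e < est_error p b \<beta>" and e: "0 < e"
    and le: "\<And>v. v \<in> unit_sphere p \<Longrightarrow> emp_mean n S (signed_half (e * t) v) \<le> c"
  shows "trunc_depth n p b S t \<le> c"
proof -
  define d where "d = vnorm p (vsub p b \<beta>)"
  define v where "v = vscale p (1 / d) (vsub p b \<beta>)"
  have d: "e < d" using b by (simp add: d_def vnorm_vsub est_error_def)
  have v: "v \<in> unit_sphere p" unfolding v_def d_def using d e by (intro vscale_in_unit_sphere) (simp add: d_def)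
  have dotp_b: "dotp p x b = dotp p x \<beta> + d * dotp p v x" for x
  proof -
    have "dotp p v x = 1 / d * (dotp p b x - dotp p \<beta> x)" by (simp add: v_def dotp_vscale dotp_vsub)
    moreover have "dotp p x z = dotp p z x" for z by (simp add: dotp_def mult.commute)
    ultimately show ?thesis using d e by simp
  qed
  have "of_bool (dotp p v x * (y - dotp p x b) \<ge> 0 \<and> \<bar>dotp p v x\<bar> \<ge> t) \<le> signed_half (e * t) v (x, y)" for x y
  proof (cases "dotp p v x * (y - dotp p x b) \<ge> 0 \<and> \<bar>dotp p v x\<bar> \<ge> t")
    case True
    define g where "g = dotp p v x"
    have g: "0 \<le> g * (y - dotp p x \<beta> - d * g)" "t \<le> \<bar>g\<bar>"
      using True by (simp_all add: g_def dotp_b algebra_simps)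
    have "e * t \<le> d * \<bar>g\<bar>" using d e g t_pos by (intro mult_mono) auto
    moreover have "0 < e * t" using e t_pos by simp
    ultimately have "t \<le> trunc_sign (e * t) (x, y) * g"
      using g t_pos by (cases "0 \<le> g") (auto simp: trunc_sign_def resid_def sgn_if zero_le_mult_iff)
    then show ?thesis by (simp add: signed_half_def g_def)
  qed (auto simp: signed_half_def)
  then have "(\<Sum>i<n. case S i of (x, y) \<Rightarrow> of_bool (dotp p v x * (y - dotp p x b) \<ge> 0 \<and> \<bar>dotp p v x\<bar> \<ge> t))
      \<le> (\<Sum>i<n. signed_half (e * t) v (S i))"
    by (intro sum_mono) (auto split: prod.split)
  then have "1 / real n * (\<Sum>i<n. case S i of (x, y) \<Rightarrow> of_bool (dotp p v x * (y - dotp p x b) \<ge> 0 \<and> \<bar>dotp p v x\<bar> \<ge> t))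
      \<le> emp_mean n S (signed_half (e * t) v)"
    by (simp add: emp_mean_def divide_right_mono)
  also have "\<dots> \<le> c" by (rule le[OF v])
  finally have *: "1 / real n * (\<Sum>i<n. case S i of (x, y) \<Rightarrow> of_bool (dotp p v x * (y - dotp p x b) \<ge> 0 \<and> \<bar>dotp p v x\<bar> \<ge> t)) \<le> c" .
  show ?thesis unfolding trunc_depth_def by (rule order.trans[OF cINF_lower[OF bdd_below_depth v] *])
qed

text \<open>The assumption \<open>gap\<close> says that the lower bound for the depth at
  \<open>\<beta>\<close> exceeds the upper bound at any point further away than \<open>e\<close>;
  \<open>3 * \<epsilon>\<close> collects one \<open>\<epsilon>\<close> from the former and two from
  the latter. Two deviation events, for sign levels \<open>0\<close> and \<open>e * t\<close>, share
  the failure probability, whence \<open>10 / \<alpha>\<close> in place of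
  \<open>5 / \<alpha>\<close>.\<close>

lemma est_error_with_prob:
  fixes \<alpha> e :: real
  assumes \<alpha>: "0 < \<alpha>" "\<alpha> < 1" and pn: "p \<le> n" and e: "0 < e" and est: "max_depth_estimator n p t est"
    and K: "K = 800 + 50 * ln (10 / \<alpha>)"
    and gap: "2 * K * sqrt (real p / real n) < gauss_tail t * (1 - 2 * gauss_tail (e * t / \<sigma>) - 3 * \<epsilon>)"
  shows "with_prob_at_least (sample_law n p \<epsilon> \<beta> \<sigma> Q) (1 - \<alpha>) (\<lambda>S. est_error p (est S) \<beta> \<le> e)"
proof -
  define M where "M = sample_law n p \<epsilon> \<beta> \<sigma> Q"
  define r where "r = sqrt (real p / real n)"
  interpret M: prob_space M unfolding M_def by (rule prob_space_sample_law[OF model])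
  have "\<exists>G\<in>sets M. 1 - \<alpha> / 2 \<le> measure M G \<and> (\<forall>S\<in>G. \<forall>v\<in>unit_sphere p.
      \<bar>emp_mean n S (signed_half s v) - (\<integral>z. signed_half s v z \<partial>\<mu>)\<bar> \<le> K * r)" for s
  proof -
    have \<alpha>2: "0 < \<alpha> / 2" "\<alpha> / 2 < 1" using \<alpha> by auto
    have K2: "800 + 50 * ln (5 / (\<alpha> / 2)) = K" by (simp add: K)
    show ?thesis
      by (rule signed_gaussian_design.uniform_deviation[OF design[of s] pn \<alpha>2, unfolded signed_half_eq K2])
        (auto simp: M_def sample_law_def r_def)
  qed
  then obtain G where G: "\<And>s. G s \<in> sets M" "\<And>s. 1 - \<alpha> / 2 \<le> measure M (G s)"
    and dev: "\<And>s S v. S \<in> G s \<Longrightarrow> v \<in> unit_sphere p \<Longrightarrow>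
      \<bar>emp_mean n S (signed_half s v) - (\<integral>z. signed_half s v z \<partial>\<mu>)\<bar> \<le> K * r"
    by metis
  let ?A = "G 0 \<inter> G (e * t)"
  show ?thesis
    unfolding with_prob_at_least_def M_def[symmetric]
  proof (intro bexI[of _ ?A] conjI subsetI)
    show "?A \<in> sets M" using G by auto
    have "measure M (space M - ?A) = measure M ((space M - G 0) \<union> (space M - G (e * t)))"
      by (intro arg_cong[where f = "measure M"]) auto
    also have "\<dots> \<le> measure M (space M - G 0) + measure M (space M - G (e * t))"
      using G by (intro measure_Un_le) auto
    also have "\<dots> \<le> \<alpha> / 2 + \<alpha> / 2"
      using G(2)[of 0] G(2)[of "e * t"] G(1) by (simp add: M.prob_compl)
    finally show "1 - \<alpha> \<le> measure M ?A"
      using G M.prob_compl[of ?A] by auto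
    fix S assume S: "S \<in> ?A"
    have SM: "S \<in> space M" using S G(1) sets.sets_into_space by blast
    then have "is_arg_max (\<lambda>b. trunc_depth n p b S t) (\<lambda>b. b \<in> Rvec p) (est S)"
      using est by (simp add: max_depth_estimator_def M_def space_sample_law[OF model])
    then have max: "trunc_depth n p \<beta> S t \<le> trunc_depth n p (est S) S t"
      using params(5) by (auto simp: is_arg_max_def not_less)
    have lower: "(1 - \<epsilon>) * gauss_tail t - K * r \<le> trunc_depth n p \<beta> S t"
    proof (rule trunc_depth_ge)
      fix v assume v: "v \<in> unit_sphere p"
      then show "(1 - \<epsilon>) * gauss_tail t - K * r \<le> emp_mean n S (signed_half 0 v)"
        using dev[of S 0 v] S signed_half_lower[OF v] by (auto simp: abs_le_iff)
    qed
    have "est_error p (est S) \<beta> \<le> e"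
    proof (rule ccontr)
      assume "\<not> est_error p (est S) \<beta> \<le> e"
      then have "trunc_depth n p (est S) S t \<le> 2 * gauss_tail t * (gauss_tail (e * t / \<sigma>) + \<epsilon>) + K * r"
      proof (intro trunc_depth_le[of e])
        fix v assume v: "v \<in> unit_sphere p"
        then show "emp_mean n S (signed_half (e * t) v) \<le> 2 * gauss_tail t * (gauss_tail (e * t / \<sigma>) + \<epsilon>) + K * r"
          using dev[of S "e * t" v] S signed_half_upper[OF v, of "e * t"] e t_pos by (auto simp: abs_le_iff)
      qed (use e in auto)
      with lower max have "(1 - \<epsilon>) * gauss_tail t - K * r \<le> 2 * gauss_tail t * (gauss_tail (e * t / \<sigma>) + \<epsilon>) + K * r"
        by linarith
      with gap show False unfolding r_def[symmetric] by (simp add: algebra_simps)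
    qed
    then show "S \<in> {x \<in> space M. est_error p (est x) \<beta> \<le> e}" using SM by simp
  qed
qed

end

section \<open>Choice of the error radius and of the truncation level\<close>

text \<open>Put \<open>y = e * t / \<sigma>\<close>. While \<open>y \<le> 1\<close>, the central
  mass is at least \<open>2/5 * y\<close>, that is
  \<open>24 * K * (r * exp (t\<^sup>2) + \<epsilon>)\<close>: the second part beats
  \<open>3 * \<epsilon>\<close>, and the first, times \<open>exp (- t\<^sup>2) / 10\<close>, leaves
  \<open>2.4 * K * r\<close>. This is where 60 comes from. For larger \<open>y\<close> the mass
  saturates, and the restrictions on \<open>t\<close> and \<open>r\<close> have to provide the
  gap.\<close>

lemma separation_gap:
  fixes K :: real and n p :: nat
  assumes K: "1 \<le> K" and p: "1 \<le> p" and n: "1 \<le> n" and \<sigma>: "0 < \<sigma>" and \<epsilon>: "0 \<le> \<epsilon>" "\<epsilon> \<le> 1/10"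
    and small: "sqrt (real p / real n) \<le> (1 / (300 * K)) ^ 5"
    and t: "0 < t" "t\<^sup>2 \<le> 0.4 * ln (real n / real p)"
    and e: "e = 60 * K * (\<sigma> / t * (sqrt (real p / real n) * exp (t\<^sup>2) + \<epsilon>))"
  shows "2 * K * sqrt (real p / real n) < gauss_tail t * (1 - 2 * gauss_tail (e * t / \<sigma>) - 3 * \<epsilon>)"
proof -
  define r where "r = sqrt (real p / real n)"
  have r: "0 < r" using p n by (simp add: r_def)
  define y where "y = e * t / \<sigma>"
  have y: "y = 60 * K * (r * exp (t\<^sup>2) + \<epsilon>)" using t \<sigma> by (simp add: y_def e r_def)
  have y0: "0 < y" unfolding y using K r \<epsilon> by (intro mult_pos_pos add_pos_nonneg) auto
  have tail: "exp (- t\<^sup>2) / 10 \<le> gauss_tail t" using t by (intro gauss_tail_ge) auto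
  have gy: "2/5 * min y 1 - 3 * \<epsilon> \<le> 1 - 2 * gauss_tail y - 3 * \<epsilon>" using gauss_central_mass_ge[OF y0] by simp
  have main: "2 * K * r < exp (- t\<^sup>2) / 10 * (2/5 * min y 1 - 3 * \<epsilon>) \<and> 0 \<le> 2/5 * min y 1 - 3 * \<epsilon>"
  proof (cases "y \<le> 1")
    case True
    have "60 * 1 * \<epsilon> \<le> 60 * K * \<epsilon>" using K \<epsilon> by (intro mult_right_mono) auto
    then have "24 * K * (r * exp (t\<^sup>2)) \<le> 2/5 * min y 1 - 3 * \<epsilon>"
      using True \<epsilon> unfolding y by (simp add: algebra_simps)
    moreover have "0 < 24 * K * (r * exp (t\<^sup>2))" using K r by simp
    moreover have "2 * K * r < exp (- t\<^sup>2) / 10 * (24 * K * (r * exp (t\<^sup>2)))"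
      using K r by (simp add: exp_minus field_simps)
    ultimately show ?thesis
      by (smt (verit, best) divide_pos_pos exp_gt_zero mult_left_mono)
  next
    case False
    have "1/10 \<le> 2/5 * min y 1 - 3 * \<epsilon>" using False \<epsilon> by simp
    moreover have "2 * K * r < exp (- t\<^sup>2) / 10 * (1/10)"
    proof -
      have r5: "r \<le> (1 / (300 * K)) ^ 5" using small by (simp add: r_def)
      \<comment> \<open>With \<open>r = u ^ 5\<close> one has \<open>n / p = u ^ (-10)\<close>, so
        the bound on \<open>t\<close> reads \<open>exp (- t\<^sup>2) \<ge> u ^ 4\<close>. One power
        of \<open>u\<close> is left over to beat the factor \<open>200 * K\<close>.\<close>
      define u where "u = root 5 r"
      have u: "0 < u" "u ^ 5 = r" using r by (simp_all add: u_def odd_real_root_pow)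
      have "u \<le> 1 / (300 * K)"
        using r5 K unfolding u(2)[symmetric] by (subst (asm) power_mono_iff) (use u in auto)
      then have "300 * K * u \<le> 1" using K by (simp add: field_simps)
      have "ln (real n / real p) = - ln (r ^ 2)" using p n by (simp add: r_def ln_div)
      also have "\<dots> = - ln (u ^ 10)" by (simp add: u(2)[symmetric] flip: power_mult)
      also have "\<dots> = - 10 * ln u" using u by (simp add: ln_realpow)
      finally have "t\<^sup>2 \<le> - (4 * ln u)" using t(2) by simp
      then have "exp (4 * ln u) \<le> exp (- t\<^sup>2)" by simp
      moreover have "exp (4 * ln u) = u ^ 4" using u exp_of_nat_mult[of 4 "ln u"] by simp
      ultimately have u4: "u ^ 4 \<le> exp (- t\<^sup>2)" by simp
      have "200 * K * r = 200 * K * u * u ^ 4" unfolding u(2)[symmetric] by (simp add: eval_nat_numeral)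
      also have "\<dots> < 1 * u ^ 4" using \<open>300 * K * u \<le> 1\<close> K u
        by (intro mult_strict_right_mono) (auto intro: order.strict_trans2[of _ "300 * K * u"])
      finally show ?thesis using u4 by simp
    qed
    ultimately show ?thesis
      by (smt (verit, best) divide_pos_pos exp_gt_zero mult_left_mono)
  qed
  have "2 * K * r < exp (- t\<^sup>2) / 10 * (2/5 * min y 1 - 3 * \<epsilon>)" using main by simp
  also have "\<dots> \<le> gauss_tail t * (1 - 2 * gauss_tail y - 3 * \<epsilon>)"
    using main tail gy by (intro mult_mono) (auto intro: order.trans[of _ "exp (- t\<^sup>2) / 10"])
  finally show ?thesis by (simp add: r_def y_def)
qed

lemma adaptive_level_props:
  fixes n p :: nat and \<epsilon> \<sigma> :: real
  assumes p: "1 \<le> p" and n: "1 \<le> n" and \<epsilon>: "0 \<le> \<epsilon>" and \<sigma>: "0 < \<sigma>"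
    and small: "sqrt (real p / real n) + \<epsilon> \<le> 1/3"
  defines "t \<equiv> adaptive_level n p \<epsilon>"
  shows "0 < t" "t \<le> sqrt (0.4 * ln (real n / real p))"
    and "\<sigma> / t * (sqrt (real p / real n) * exp (t\<^sup>2) + \<epsilon>) \<le> 8 * adaptive_rate n p \<epsilon> \<sigma>"
proof -
  define r where "r = sqrt (real p / real n)"
  define L where "L = real n * \<epsilon>\<^sup>2 / real p + exp 1"
  define l where "l = sqrt (ln L)"
  have r: "0 < r" "r\<^sup>2 = real p / real n" using p n by (simp_all add: r_def)
  have L: "exp 1 \<le> L" unfolding L_def using \<epsilon> by simp
  have L0: "0 < L" using L by (meson exp_gt_zero order_less_le_trans)
  have lnL: "1 \<le> ln L" using L L0 by (simp add: ln_ge_iff)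
  have l: "1 \<le> l" "l\<^sup>2 = ln L" using lnL by (simp_all add: l_def)
  have t: "t = l / 2" by (simp add: t_def adaptive_level_def l_def L_def)
  show "0 < t" using l t by simp
  have t2: "t\<^sup>2 = ln L / 4" by (simp add: t power_divide l)
  have np: "9 \<le> real n / real p"
  proof -
    have "r \<le> 1/3" using small \<epsilon> by (simp add: r_def)
    then have "r\<^sup>2 \<le> (1/3)\<^sup>2" using r by (intro power_mono) auto
    then have "real p / real n \<le> 1/9" unfolding r(2) by (simp add: power2_eq_square)
    then show ?thesis using p n by (simp add: field_simps)
  qed
  \<comment> \<open>From \<open>\<epsilon> \<le> 1/3\<close> and \<open>n / p \<ge> 9\<close>: one
    ninth of \<open>n / p\<close> plus \<open>exp 1 \<le> 3\<close> stays below
    \<open>n / p\<close>. Hence the adaptive level, whose square is \<open>ln L / 4\<close>, lies in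
    the admissible range.\<close>
  have "L \<le> real n / real p"
  proof -
    have "\<epsilon> \<le> 1/3" using small r unfolding r_def by linarith
    then have "\<epsilon>\<^sup>2 \<le> (1/3)\<^sup>2" using \<epsilon> by (intro power_mono) auto
    then have "real n / real p * \<epsilon>\<^sup>2 \<le> real n / real p * (1/9)" by (intro mult_left_mono) (auto simp: power2_eq_square)
    then show ?thesis using np exp_le unfolding L_def by simp
  qed
  then have "ln L \<le> ln (real n / real p)" using L0 p n by simp
  then have "t\<^sup>2 \<le> 0.4 * ln (real n / real p)" using t2 lnL by simp
  then show "t \<le> sqrt (0.4 * ln (real n / real p))" by (rule real_le_rsqrt)
  define w where "w = exp (t\<^sup>2)"
  have w4: "w ^ 4 = L" using L0 by (simp add: w_def t2 flip: exp_of_nat_mult)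
  have w1: "1 \<le> w" by (simp add: w_def)
  \<comment> \<open>Here \<open>w\<close> is the fourth root of \<open>L\<close>. If
    \<open>w > 3\<close>, then \<open>w\<^sup>2 + 3 \<le> w ^ 4\<close>, so \<open>w\<^sup>2\<close>
    is at most \<open>\<epsilon>\<^sup>2 / r\<^sup>2\<close> and
    \<open>r * w \<le> \<epsilon>\<close>. If \<open>w \<le> 3\<close>, a term of order
    \<open>r\<close> suffices; the factor \<open>l \<ge> 1\<close> is inserted because it cancels
    when dividing by \<open>t = l / 2\<close>.\<close>
  have key: "r * w \<le> 3 * r * l + \<epsilon>"
  proof (cases "w \<le> 3")
    case True
    then have "r * w \<le> r * (3 * l)" using r l by (intro mult_left_mono) auto
    then show ?thesis using \<epsilon> by simp
  next
    case False
    have "w\<^sup>2 + 3 \<le> w ^ 4"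
    proof -
      have "3 * 3 \<le> w * w" using False by (intro mult_mono) auto
      then have "9 * (w * w) \<le> (w * w) * (w * w)" by (intro mult_right_mono) auto
      then show ?thesis using \<open>3 * 3 \<le> w * w\<close> by (simp add: eval_nat_numeral mult.assoc)
    qed
    then have "w\<^sup>2 \<le> \<epsilon>\<^sup>2 / r\<^sup>2" using w4 exp_le unfolding L_def r(2) by (simp add: mult.commute)
    then have "(r * w)\<^sup>2 \<le> \<epsilon>\<^sup>2" using r(1) by (simp add: power_mult_distrib pos_le_divide_eq mult.commute)
    then have "r * w \<le> \<epsilon>" using \<epsilon> by (rule power2_le_imp_le)
    moreover have "0 \<le> 3 * r * l" using r l by simp
    ultimately show ?thesis by linarith
  qed
  have "\<sigma> / t * (r * w + \<epsilon>) \<le> \<sigma> / t * (3 * r * l + 2 * \<epsilon>)"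
    using key \<sigma> \<open>0 < t\<close> by (intro mult_left_mono) auto
  also have "\<dots> = \<sigma> * (6 * r + 4 * (\<epsilon> / l))" using l by (simp add: t field_simps)
  also have "\<dots> \<le> \<sigma> * (8 * r + 8 * (\<epsilon> / l))"
    using \<sigma> r \<epsilon> l by (intro mult_left_mono add_mono mult_right_mono) auto
  also have "\<dots> = 8 * adaptive_rate n p \<epsilon> \<sigma>"
    by (simp add: adaptive_rate_def r_def l_def L_def algebra_simps)
  finally show "\<sigma> / t * (sqrt (real p / real n) * exp (t\<^sup>2) + \<epsilon>) \<le> 8 * adaptive_rate n p \<epsilon> \<sigma>"
    by (simp add: r_def w_def)
qed

lemma with_prob_at_least_mono:
  assumes "with_prob_at_least M q P" "\<And>x. x \<in> space M \<Longrightarrow> P x \<Longrightarrow> P' x"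
  shows "with_prob_at_least M q P'"
  using assms unfolding with_prob_at_least_def by (smt (verit, best) mem_Collect_eq subset_iff)

theorem theorem3p1:
  fixes \<alpha> :: real
  assumes "0 < \<alpha>" and "\<alpha> < 1"
  shows "\<exists>C>0. \<exists>c>0. \<exists>C'>0.
    \<forall>(n::nat) (p::nat) (\<epsilon>::real) (\<beta>::vec) (\<sigma>::real) (Q::vec \<Rightarrow> real measure).
      adaptive_contamination_model n p \<epsilon> \<beta> \<sigma> Q \<and> sqrt (real p / real n) + \<epsilon> \<le> c \<longrightarrow>
        (\<forall>t est. 0 \<le> t \<and> t \<le> sqrt (0.4 * ln (real n / real p)) \<and> max_depth_estimator n p t est \<longrightarrow>
           with_prob_at_least (sample_law n p \<epsilon> \<beta> \<sigma> Q) (1 - \<alpha>)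
             (\<lambda>S. ereal (est_error p (est S) \<beta>) \<le> ereal C * trunc_rate n p \<epsilon> \<sigma> t)) \<and>
        (\<forall>est. max_depth_estimator n p (adaptive_level n p \<epsilon>) est \<longrightarrow>
           with_prob_at_least (sample_law n p \<epsilon> \<beta> \<sigma> Q) (1 - \<alpha>)
             (\<lambda>S. est_error p (est S) \<beta> \<le> C' * adaptive_rate n p \<epsilon> \<sigma>))"
proof -
  define K where "K = 800 + 50 * ln (10 / \<alpha>)"
  define c where "c = (1 / (300 * K)) ^ 5"
  have "0 < ln (10 / \<alpha>)" using assms by (intro ln_gt_zero) (simp add: field_simps)
  then have K: "1 \<le> K" by (simp add: K_def)
  have c: "0 < c" "c \<le> 1/10"
  proof -
    show "0 < c" using K by (simp add: c_def)
    have "1 / (300 * K) \<le> 1 / 300" using K by (intro divide_left_mono) auto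
    then have "c \<le> (1 / 300) ^ 5" unfolding c_def using K by (intro power_mono) auto
    then show "c \<le> 1/10" by (simp add: eval_nat_numeral)
  qed
  have main: "with_prob_at_least (sample_law n p \<epsilon> \<beta> \<sigma> Q) (1 - \<alpha>)
      (\<lambda>S. est_error p (est S) \<beta> \<le> 60 * K * (\<sigma> / t * (sqrt (real p / real n) * exp (t\<^sup>2) + \<epsilon>)))"
    if m: "adaptive_contamination_model n p \<epsilon> \<beta> \<sigma> Q" and small: "sqrt (real p / real n) + \<epsilon> \<le> c"
      and t: "0 < t" "t \<le> sqrt (0.4 * ln (real n / real p))" and est: "max_depth_estimator n p t est"
    for n p \<epsilon> \<beta> \<sigma> Q t est
  proof -
    interpret contaminated_regression n p \<epsilon> \<beta> \<sigma> Q t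
      using m t by unfold_locales
    have s: "sqrt (real p / real n) \<le> c" "\<epsilon> \<le> c"
    proof -
      have "0 \<le> sqrt (real p / real n)" by simp
      then show "sqrt (real p / real n) \<le> c" "\<epsilon> \<le> c" using small params(3) by linarith+
    qed
    have "sqrt (real p / real n) \<le> 1" using s c by linarith
    then have "p \<le> n" using params by (simp add: divide_le_eq)
    \<comment> \<open>The real \<open>sqrt\<close> is negative at negative arguments, so a positive
      \<open>t\<close> below it forces a positive radicand.\<close>
    have "0 \<le> 0.4 * ln (real n / real p)"
      using t by (metis less_le_trans real_sqrt_gt_0_iff less_imp_le)
    then have "t\<^sup>2 \<le> 0.4 * ln (real n / real p)"
      using t by (metis less_imp_le power_mono real_sqrt_pow2)
    have e: "0 < 60 * K * (\<sigma> / t * (sqrt (real p / real n) * exp (t\<^sup>2) + \<epsilon>))"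
      using K params t by (intro mult_pos_pos add_pos_nonneg) auto
    show ?thesis
      by (rule est_error_with_prob[OF assms \<open>p \<le> n\<close> e est K_def])
         (rule separation_gap[OF K params(2,1,6,3) _ _ t(1) \<open>t\<^sup>2 \<le> _\<close> refl]; use s c in \<open>simp add: c_def\<close>)
  qed
  have pos: "0 < 60 * K" "0 < 480 * K" using K by auto
  show ?thesis
  \<comment> \<open>The constant \<open>480 * K\<close> is \<open>60 * K\<close> times the factor 8
    lost when the bound at the adaptive level is compared with the adaptive rate.\<close>
  proof (rule exI[of _ "60 * K"], rule conjI[OF pos(1)], rule exI[of _ c], rule conjI[OF c(1)],
      rule exI[of _ "480 * K"], rule conjI[OF pos(2)], intro allI impI conjI)
    fix n p \<epsilon> \<beta> \<sigma> Q t est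
    assume m: "adaptive_contamination_model n p \<epsilon> \<beta> \<sigma> Q \<and> sqrt (real p / real n) + \<epsilon> \<le> c"
      and t: "0 \<le> t \<and> t \<le> sqrt (0.4 * ln (real n / real p)) \<and> max_depth_estimator n p t est"
    show "with_prob_at_least (sample_law n p \<epsilon> \<beta> \<sigma> Q) (1 - \<alpha>)
        (\<lambda>S. ereal (est_error p (est S) \<beta>) \<le> ereal (60 * K) * trunc_rate n p \<epsilon> \<sigma> t)"
    proof (cases "t = 0")
      case True
      \<comment> \<open>At \<open>t = 0\<close> the right-hand side is infinite, and the whole
        sample space serves as the event.\<close>
      interpret prob_space "sample_law n p \<epsilon> \<beta> \<sigma> Q" using m by (intro prob_space_sample_law) auto
      show ?thesis unfolding with_prob_at_least_def
        using K True assms prob_space by (intro bexI[of _ "space (sample_law n p \<epsilon> \<beta> \<sigma> Q)"]) (auto simp: trunc_rate_def)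
    next
      case False
      show ?thesis
        by (rule with_prob_at_least_mono[OF main[of n p \<epsilon> \<beta> \<sigma> Q t est]])
          (use m t False in \<open>auto simp: trunc_rate_def\<close>)
    qed
  next
    fix n p \<epsilon> \<beta> \<sigma> Q est
    assume m: "adaptive_contamination_model n p \<epsilon> \<beta> \<sigma> Q \<and> sqrt (real p / real n) + \<epsilon> \<le> c"
      and est: "max_depth_estimator n p (adaptive_level n p \<epsilon>) est"
    have par: "1 \<le> p" "1 \<le> n" "0 \<le> \<epsilon>" "0 < \<sigma>" "sqrt (real p / real n) + \<epsilon> \<le> 1/3"
      using m c by (auto simp: adaptive_contamination_model_def)
    note lev = adaptive_level_props[OF par]
    show "with_prob_at_least (sample_law n p \<epsilon> \<beta> \<sigma> Q) (1 - \<alpha>)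
        (\<lambda>S. est_error p (est S) \<beta> \<le> 480 * K * adaptive_rate n p \<epsilon> \<sigma>)"
    proof (rule with_prob_at_least_mono[OF main[OF _ _ lev(1,2) est]])
      fix S assume "est_error p (est S) \<beta> \<le> 60 * K * (\<sigma> / adaptive_level n p \<epsilon> *
        (sqrt (real p / real n) * exp ((adaptive_level n p \<epsilon>)\<^sup>2) + \<epsilon>))"
      also have "\<dots> \<le> 60 * K * (8 * adaptive_rate n p \<epsilon> \<sigma>)"
        using K by (intro mult_left_mono lev(3)) auto
      finally show "est_error p (est S) \<beta> \<le> 480 * K * adaptive_rate n p \<epsilon> \<sigma>" by simp
    qed (use m in auto)
  qed
qed

end
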